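(* There exists a bounded open set $\Omega\subset\mathbb{R}^2$ such that $H^1_{\rm tr}(\Omega)\setminus\widetilde H^1(\Omega)$ is not empty, where $\widetilde H^1(\Omega)$ is the closure of $H^1(\Omega)\cap C^0(\overline\Omega)$ in $H^1(\Omega)$.
   Context: Here $d=2$. $\partial\Omega=\overline{\Omega}\setminus\Omega$; $\mathbb{S}^{d-1}$ is the Euclidean unit sphere of $\mathbb{R}^d$; $]a,b[$ denotes the open real interval. For $\theta\in\mathbb{S}^{d-1}$, $W_\theta(\Omega)$ is the set of $u\in L^2(\Omega)$ whose weak derivative $\partial_\theta u$ in direction $\theta$ is in $L^2(\Omega)$; $H^1(\Omega)\subset W_\theta(\Omega)$. $H_\theta=\{y\in\mathbb{R}^d: y\cdot\theta=0\}$; $\mathcal{P}_\theta(x)=x-(x\cdot\theta)\theta$; $\lambda^{d-1}$ is the $(d-1)$-dimensional Lebesgue measure on $H_\theta$ (identified isometrically with $\mathbb{R}^{d-1}$). For $y\in H_\theta$, $\omega_\theta(y)=\{s\in\mathbb{R}: s\theta+y\in\Omega\}$, and $\mathcal{I}_\theta(y)$ is the countable set of disjoint bounded open intervals (the connected components) whose union is $\omega_\theta(y)$. Directional trace: a function $g:\partial\Omega\to\mathbb{R}$ is a directional trace of $u\in W_\theta(\Omega)$ in the direction $\theta$ if there exist a representative of $u$ (still denoted $u$) and a set $A\subset\mathcal{P}_\theta(\Omega)$ such that (1) $\mathcal{P}_\theta(\Omega)\setminus A$ is $\lambda^{d-1}$-negligible; (2) for all $y\in A$, $u_{\theta,y}:s\mapsto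 u(s\theta+y)$ is an element of $H^1(\omega_\theta(y))$ and, for all $]\alpha,\beta[\,\in\mathcal{I}_\theta(y)$, taking the representative of $u_{\theta,y}$ which is continuous on $]\alpha,\beta]$, one has $g(\beta\theta+y)=u_{\theta,y}(\beta)$. Directional measure: for $x\in\Omega$, $\delta_\theta(x)=\sup\{s\ge 0:\forall t\in[0,s[,\ x+t\theta\in\Omega\}$ and $\Phi_\theta(x)=x+\delta_\theta(x)\theta\in\partial\Omega$. The finite Borel measure $\mu_\theta$ on $\partial\Omega$ is $\mu_\theta(A)=\int_\Omega\chi_A(\Phi_\theta(x))\,dx$ for Borel $A\subset\partial\Omega$. $\gamma_\theta u$ is the set of all directional traces of $u$ in direction $\theta$, an equivalence class for equality $\mu_\theta$-a.e. $\mathcal{L}^2(\partial\Omega,(\mu_\theta)_{\theta\in\mathbb{S}^{d-1}})$ is the set of functions $f:\partial\Omega\to\mathbb{R}$ for which there is $M\ge 0$ such that for every $\theta\in\mathbb{S}^{d-1}$ there is $g_\theta\in\mathcal{L}^2(\partial\Omega,\mu_\theta)$ with $f=g_\theta$ $\mu_\theta$-a.e. and $\int|g_\theta|^2d\mu_\theta\le M$. $L^2(\partial\Omega,(\mu_\theta)_{\theta\in\mathbb{S}^{d-1}})$ is its quotient by the relation "$f=g$ $\mu_\theta$-a.e. for every $\theta\in\mathbb{S}^{d-1}$". $u\in H^1(\Omega)$ belongs to $H^1_{\rm tr}(\Omega)$ if there is $g\in L^2(\partial\Omega,(\mu_\theta)_{\theta\in\mathbb{S}^{d-1}})$ such that for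 all $\theta\in\mathbb{S}^{d-1}$, $\gamma_\theta u(z)=g(z)$ for $\mu_\theta$-a.e. $z\in\partial\Omega$. *)

theory Defs
  imports "HOL-Analysis.Analysis"
begin

text \<open>
  Elements of \<open>L\<^sup>2(\<Omega>)\<close>, \<open>H\<^sup>1(\<Omega>)\<close> etc. are represented by total functions, of which only the
  values on \<open>\<Omega>\<close> matter; all sets of functions on \<open>\<Omega>\<close> below are invariant under equality
  Lebesgue-a.e. on \<open>\<Omega>\<close>, so no quotient is taken. Likewise functions on the boundary are total
  functions of which only the values on \<open>frontier \<Omega>\<close> matter. The set \<open>\<Omega>\<close> is always meant to be
  open, so that \<open>frontier \<Omega> = closure \<Omega> - \<Omega>\<close>.
\<close>

section \<open>Sobolev spaces\<close>

definition square_integrable :: "'a measure \<Rightarrow> ('a \<Rightarrow> real) \<Rightarrow> bool" where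
  "square_integrable M f \<longleftrightarrow> f \<in> borel_measurable M \<and> integrable M (\<lambda>x. (f x)\<^sup>2)"

primrec Ck :: "nat \<Rightarrow> ('a::euclidean_space \<Rightarrow> real) \<Rightarrow> bool" where
  "Ck 0 f \<longleftrightarrow> continuous_on UNIV f"
| "Ck (Suc k) f \<longleftrightarrow> (\<forall>x. f differentiable (at x)) \<and>
     (\<forall>i\<in>Basis. Ck k (\<lambda>x. frechet_derivative f (at x) i))"

definition test_function :: "'a::euclidean_space set \<Rightarrow> ('a \<Rightarrow> real) \<Rightarrow> bool" where
  "test_function \<Omega> \<phi> \<longleftrightarrow> (\<forall>k. Ck k \<phi>) \<and>
     compact (closure {x. \<phi> x \<noteq> 0}) \<and> closure {x. \<phi> x \<noteq> 0} \<subseteq> \<Omega>"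

definition is_weak_deriv ::
    "'a::euclidean_space set \<Rightarrow> 'a \<Rightarrow> ('a \<Rightarrow> real) \<Rightarrow> ('a \<Rightarrow> real) \<Rightarrow> bool" where
  "is_weak_deriv \<Omega> \<theta> u v \<longleftrightarrow> (\<forall>\<phi>. test_function \<Omega> \<phi> \<longrightarrow>
     (LINT x|lebesgue_on \<Omega>. u x * frechet_derivative \<phi> (at x) \<theta>)
       = - (LINT x|lebesgue_on \<Omega>. v x * \<phi> x))"

definition W :: "'a::euclidean_space \<Rightarrow> 'a set \<Rightarrow> ('a \<Rightarrow> real) set" where
  "W \<theta> \<Omega> = {u. square_integrable (lebesgue_on \<Omega>) u \<and>
     (\<exists>v. square_integrable (lebesgue_on \<Omega>) v \<and> is_weak_deriv \<Omega> \<theta> u v)}"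

definition H1 :: "'a::euclidean_space set \<Rightarrow> ('a \<Rightarrow> real) set" where
  "H1 \<Omega> = (\<Inter>i\<in>Basis. W i \<Omega>)"

text \<open>The choice is unique up to equality a.e. on \<open>\<Omega>\<close>.\<close>

definition weak_deriv :: "'a::euclidean_space set \<Rightarrow> 'a \<Rightarrow> ('a \<Rightarrow> real) \<Rightarrow> 'a \<Rightarrow> real" where
  "weak_deriv \<Omega> \<theta> u =
     (SOME v. square_integrable (lebesgue_on \<Omega>) v \<and> is_weak_deriv \<Omega> \<theta> u v)"

definition H1_norm :: "'a::euclidean_space set \<Rightarrow> ('a \<Rightarrow> real) \<Rightarrow> real" where
  "H1_norm \<Omega> u = sqrt ((LINT x|lebesgue_on \<Omega>. (u x)\<^sup>2) +
     (\<Sum>i\<in>Basis. LINT x|lebesgue_on \<Omega>. (weak_deriv \<Omega> i u x)\<^sup>2))"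

definition H1_tilde :: "'a::euclidean_space set \<Rightarrow> ('a \<Rightarrow> real) set" where
  "H1_tilde \<Omega> = {u \<in> H1 \<Omega>. \<forall>\<epsilon>>0. \<exists>v \<in> H1 \<Omega>.
     continuous_on (closure \<Omega>) v \<and> H1_norm \<Omega> (\<lambda>x. u x - v x) < \<epsilon>}"

section \<open>Directional traces\<close>

definition proj_perp :: "'a::euclidean_space \<Rightarrow> 'a \<Rightarrow> 'a" where
  "proj_perp \<theta> x = x - (x \<bullet> \<theta>) *\<^sub>R \<theta>"

text \<open>
  For a unit vector \<open>\<theta>\<close> of the plane, \<open>t \<mapsto> t *\<^sub>R rot90 \<theta>\<close> is an isometry from the line onto
  \<open>H\<^sub>\<theta> = {y. y \<bullet> \<theta> = 0}\<close>, along which Lebesgue measure is transported.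
\<close>

definition rot90 :: "real^2 \<Rightarrow> real^2" where
  "rot90 \<theta> = vector [- \<theta>$2, \<theta>$1]"

definition lebesgue_perp :: "real^2 \<Rightarrow> (real^2) measure" where
  "lebesgue_perp \<theta> = embed_measure lebesgue (\<lambda>t. t *\<^sub>R rot90 \<theta>)"

definition line_slice :: "'a::euclidean_space set \<Rightarrow> 'a \<Rightarrow> 'a \<Rightarrow> real set" where
  "line_slice \<Omega> \<theta> y = {s. s *\<^sub>R \<theta> + y \<in> \<Omega>}"

text \<open>
  Below, \<open>u'\<close> is the representative of \<open>u\<close>, and \<open>w\<close> is the representative of the restriction of
  \<open>s \<mapsto> u' (s *\<^sub>R \<theta> + y)\<close> to the component \<open>{\<alpha><..<\<beta>}\<close> which is continuous up to \<open>\<beta>\<close>; its value at \<open>\<beta>\<close> is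
  unique.
\<close>

definition directional_trace ::
    "(real^2) set \<Rightarrow> real^2 \<Rightarrow> (real^2 \<Rightarrow> real) \<Rightarrow> (real^2 \<Rightarrow> real) \<Rightarrow> bool" where
  "directional_trace \<Omega> \<theta> u g \<longleftrightarrow> u \<in> W \<theta> \<Omega> \<and>
     (\<exists>u' A. (AE x in lebesgue_on \<Omega>. u' x = u x) \<and>
        A \<subseteq> proj_perp \<theta> ` \<Omega> \<and>
        proj_perp \<theta> ` \<Omega> - A \<in> null_sets (lebesgue_perp \<theta>) \<and>
        (\<forall>y\<in>A. (\<lambda>s. u' (s *\<^sub>R \<theta> + y)) \<in> H1 (line_slice \<Omega> \<theta> y) \<and>
           (\<forall>\<alpha> \<beta>. {\<alpha><..<\<beta>} \<in> components (line_slice \<Omega> \<theta> y) \<longrightarrow>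
              (\<exists>w. (AE s in lebesgue_on {\<alpha><..<\<beta>}. w s = u' (s *\<^sub>R \<theta> + y)) \<and>
                   continuous_on {\<alpha><..\<beta>} w \<and> g (\<beta> *\<^sub>R \<theta> + y) = w \<beta>))))"

definition gamma :: "(real^2) set \<Rightarrow> real^2 \<Rightarrow> (real^2 \<Rightarrow> real) \<Rightarrow> (real^2 \<Rightarrow> real) set" where
  "gamma \<Omega> \<theta> u = {g. directional_trace \<Omega> \<theta> u g}"

section \<open>Directional measures\<close>

definition exit_time :: "'a::euclidean_space set \<Rightarrow> 'a \<Rightarrow> 'a \<Rightarrow> real" where
  "exit_time \<Omega> \<theta> x = Sup {s. 0 \<le> s \<and> (\<forall>t\<in>{0..<s}. x + t *\<^sub>R \<theta> \<in> \<Omega>)}"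

definition exit_point :: "'a::euclidean_space set \<Rightarrow> 'a \<Rightarrow> 'a \<Rightarrow> 'a" where
  "exit_point \<Omega> \<theta> x = x + exit_time \<Omega> \<theta> x *\<^sub>R \<theta>"

text \<open>
  The Borel measure \<open>A \<mapsto> \<integral>\<^sub>\<Omega> \<chi>\<^sub>A (exit_point \<Omega> \<theta> x) dx\<close> on the boundary, as an image measure. The
  restriction to the frontier is justified for bounded open \<open>\<Omega>\<close> and unit \<open>\<theta>\<close>: then
  \<open>exit_point \<Omega> \<theta>\<close> maps \<open>\<Omega>\<close> into \<open>frontier \<Omega>\<close> and is Borel, \<open>exit_time \<Omega> \<theta>\<close> being lower
  semicontinuous on \<open>\<Omega>\<close>.
\<close>

definition dir_measure :: "'a::euclidean_space set \<Rightarrow> 'a \<Rightarrow> 'a measure" where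
  "dir_measure \<Omega> \<theta> =
     distr (lebesgue_on \<Omega>) (restrict_space borel (frontier \<Omega>)) (exit_point \<Omega> \<theta>)"

definition L2_boundary :: "'a::euclidean_space set \<Rightarrow> ('a \<Rightarrow> real) set" where
  "L2_boundary \<Omega> = {f. \<exists>M\<ge>0. \<forall>\<theta>\<in>sphere 0 1. \<exists>g.
     square_integrable (dir_measure \<Omega> \<theta>) g \<and>
     (AE z in dir_measure \<Omega> \<theta>. f z = g z) \<and>
     (LINT z|dir_measure \<Omega> \<theta>. (g z)\<^sup>2) \<le> M}"

text \<open>
  Since \<open>gamma \<Omega> \<theta> u\<close> is an equivalence class for equality \<open>dir_measure \<Omega> \<theta>\<close>-a.e., it equals
  \<open>g\<close> a.e. iff one of its members does.
\<close>

definition H1_tr :: "(real^2) set \<Rightarrow> (real^2 \<Rightarrow> real) set" where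
  "H1_tr \<Omega> = {u \<in> H1 \<Omega>. \<exists>g \<in> L2_boundary \<Omega>. \<forall>\<theta>\<in>sphere 0 1.
     \<exists>h \<in> gamma \<Omega> \<theta> u. AE z in dir_measure \<Omega> \<theta>. h z = g z}"

end

theory Submission
  imports Defs
begin

text \<open>
  Write \<open>c = x\<^sub>1 - x\<^sub>2\<^sup>2\<close>, so that the curves \<open>c = const\<close> are translated parabolas crossing the horizontal
  axis. The domain is \<open>0 < c < 1\<close>, \<open>0 < \<bar>x\<^sub>2\<bar> < 1\<close>, from whose upper part slits are removed: for each
  \<open>n\<close>, the arcs \<open>8\<^sup>n c \<in> \<int>\<close>, \<open>0 < x\<^sub>2 \<le> 2\<^sup>-\<^sup>n\<close>. The axis thus separates a plain lower part from an upper
  part in which ever finer parabolic slits come down to it. The function \<open>u\<close> is \<open>1\<close> above and \<open>0\<close> below;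
  being locally constant on the domain, it has vanishing weak derivatives.

  \<^emph>\<open>The function \<open>u\<close> has a trace independent of the direction.\<close> A straight line approaching the axis
  from above is not a parabola: over a small height \<open>q = 2\<^sup>-\<^sup>n\<close> its value of \<open>c\<close> changes by at least \<open>q\<^sup>2\<close>,
  hence by more than the distance \<open>q\<^sup>3\<close> of the \<open>n\<close>-th slits, and so it hits a slit first
  (\<open>line_to_axis_crosses_slit\<close>). Consequently the axis is seen along straight lines from below only, and the
  indicator of the open upper half plane is a trace of \<open>u\<close> in every direction. Taking this indicator for
  \<open>u\<close> itself, \<open>u\<close> is its own trace.

  \<^emph>\<open>The function \<open>u\<close> is not a limit of functions \<open>v\<close> that are continuous up to the boundary.\<close> Along the
  parabolas, unlike along straight lines, the axis can be reached from above. Down to height \<open>2\<^sup>-\<^sup>N\<close> the tubes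
  \<open>k < 8\<^sup>N c < k + 1\<close> are free of slits, and smooth functions of \<open>c\<close> supported in these tubes, multiplied by a
  cutoff in \<open>x\<^sub>2\<close>, are test functions. As the field \<open>(2 x\<^sub>2, 1)\<close> is tangent to the parabolas, testing the
  weak derivatives of \<open>w = u - v\<close> in this direction controls the mean jump of \<open>w\<close> between the heights
  \<open>\<plusminus> 2\<^sup>-\<^sup>N\<close> by the \<open>H\<^sup>1\<close> norm of \<open>w\<close>, uniformly in \<open>N\<close> (\<open>jump_bounded_by_H1\<close>). Since \<open>v\<close> takes a single
  value at each point of the axis, this mean jump tends to that of \<open>u\<close>, a positive constant
  (\<open>jump_integral_lower_bound\<close>). Hence the norm of \<open>w\<close> cannot be small.
\<close>

section \<open>Smooth functions\<close>

lemma Ck_SucI: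
  assumes "\<And>x. (f has_derivative f' x) (at x)"
    and "\<And>i. i \<in> Basis \<Longrightarrow> Ck k (\<lambda>x. f' x i)"
  shows "Ck (Suc k) f"
proof -
  have "frechet_derivative f (at x) = f' x" for x
    using frechet_derivative_at[OF assms(1)] by metis
  then show ?thesis
    using assms by (auto simp: differentiable_def)
qed

lemma Ck_Suc_imp_has_derivative:
  assumes "Ck (Suc k) f"
  shows "(f has_derivative frechet_derivative f (at x)) (at x)"
  using assms by (simp add: frechet_derivative_works)

lemma Ck_Suc_imp_Ck: "Ck (Suc k) f \<Longrightarrow> Ck k f"
proof (induction k arbitrary: f)
  case 0
  then show ?case
    by (auto intro!: continuous_at_imp_continuous_on differentiable_imp_continuous_within)
next
  case (Suc k)
  then show ?case by auto
qed

lemma Ck_continuous_on: "Ck k f \<Longrightarrow> continuous_on S f"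
proof (induction k)
  case 0
  then show ?case by (auto intro: continuous_on_subset)
next
  case (Suc k)
  then show ?case using Ck_Suc_imp_Ck by blast
qed

lemma Ck_const: "Ck k (\<lambda>x. a)"
proof (induction k arbitrary: a)
  case (Suc k)
  show ?case by (rule Ck_SucI[where f' = "\<lambda>_ _. 0"]) (auto simp: Suc)
qed auto

lemma Ck_linear:
  assumes "bounded_linear f"
  shows "Ck k f"
proof (cases k)
  case 0
  then show ?thesis using assms by (simp add: linear_continuous_on)
next
  case (Suc j)
  show ?thesis unfolding Suc
    by (rule Ck_SucI[where f' = "\<lambda>_. f"])
       (auto simp: bounded_linear_imp_has_derivative assms Ck_const)
qed

lemma Ck_ident: "Ck k (\<lambda>x::real. x)"
  by (rule Ck_linear[OF bounded_linear_ident])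

lemma Ck_add: "Ck k f \<Longrightarrow> Ck k g \<Longrightarrow> Ck k (\<lambda>x. f x + g x)"
proof (induction k arbitrary: f g)
  case 0
  then show ?case by (simp add: continuous_on_add)
next
  case (Suc k)
  show ?case
    by (rule Ck_SucI[where f' = "\<lambda>x i. frechet_derivative f (at x) i + frechet_derivative g (at x) i"])
       (use Suc in \<open>auto intro!: has_derivative_add simp: frechet_derivative_works[symmetric]\<close>)
qed

lemma Ck_sum: "(\<And>i. i \<in> A \<Longrightarrow> Ck k (f i)) \<Longrightarrow> Ck k (\<lambda>x. \<Sum>i\<in>A. f i x)"
  by (induction A rule: infinite_finite_induct) (auto simp: Ck_const Ck_add)

lemma Ck_mult: "Ck k f \<Longrightarrow> Ck k g \<Longrightarrow> Ck k (\<lambda>x. f x * g x)"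
proof (induction k arbitrary: f g)
  case 0
  then show ?case by (simp add: continuous_on_mult)
next
  case (Suc k)
  show ?case
  proof (rule Ck_SucI)
    show "((\<lambda>x. f x * g x) has_derivative
        (\<lambda>i. f x * frechet_derivative g (at x) i + frechet_derivative f (at x) i * g x)) (at x)" for x
      by (intro has_derivative_mult Ck_Suc_imp_has_derivative[OF Suc.prems(1)]
          Ck_Suc_imp_has_derivative[OF Suc.prems(2)])
    show "Ck k (\<lambda>x. f x * frechet_derivative g (at x) i + frechet_derivative f (at x) i * g x)"
      if "i \<in> Basis" for i
      using Suc.prems that
      by (intro Ck_add Suc.IH) (auto intro: Ck_Suc_imp_Ck)
  qed
qed

lemma Ck_diff: "Ck k f \<Longrightarrow> Ck k g \<Longrightarrow> Ck k (\<lambda>x. f x - g x)"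
  using Ck_add[of k f "\<lambda>x. (-1) * g x"] Ck_mult[of k "\<lambda>_. -1" g] by (simp add: Ck_const)

lemma Ck_Suc_imp_DERIV:
  fixes g :: "real \<Rightarrow> real"
  assumes "Ck (Suc k) g"
  shows "(g has_real_derivative frechet_derivative g (at t) 1) (at t)"
proof -
  note deriv = Ck_Suc_imp_has_derivative[OF assms, of t]
  have "frechet_derivative g (at t) s = frechet_derivative g (at t) 1 * s" for s
    using linear_cmul[OF has_derivative_linear[OF deriv], of s 1] by (simp add: mult.commute)
  then have "frechet_derivative g (at t) = (*) (frechet_derivative g (at t) 1)" by (rule ext)
  then show ?thesis unfolding has_field_derivative_def using deriv by metis
qed

lemma Ck_compose:
  fixes g :: "real \<Rightarrow> real"
  shows "Ck k g \<Longrightarrow> Ck k p \<Longrightarrow> Ck k (\<lambda>x. g (p x))"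
proof (induction k arbitrary: g)
  case 0
  then show ?case by (auto intro: continuous_on_compose2[of UNIV g UNIV p])
next
  case (Suc k)
  let ?g' = "\<lambda>t. frechet_derivative g (at t) 1"
  show ?case
  proof (rule Ck_SucI)
    show "((\<lambda>x. g (p x)) has_derivative (\<lambda>i. ?g' (p x) * frechet_derivative p (at x) i)) (at x)" for x
      by (rule has_derivative_compose[OF Ck_Suc_imp_has_derivative[OF Suc.prems(2)]
            Ck_Suc_imp_DERIV[OF Suc.prems(1), unfolded has_field_derivative_def]])
    show "Ck k (\<lambda>x. ?g' (p x) * frechet_derivative p (at x) i)" if "i \<in> Basis" for i
    proof (rule Ck_mult)
      show "Ck k (\<lambda>x. ?g' (p x))"
        using Suc.prems by (intro Suc.IH[of ?g'] Ck_Suc_imp_Ck[of k p]) auto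
      show "Ck k (\<lambda>x. frechet_derivative p (at x) i)"
        using Suc.prems that by simp
    qed
  qed
qed

lemma Ck_Suc_real:
  fixes f :: "real \<Rightarrow> real"
  assumes "\<And>t. (f has_real_derivative f' t) (at t)" and "Ck k f'"
  shows "Ck (Suc k) f"
  by (rule Ck_SucI[where f' = "\<lambda>t s. f' t * s"])
     (use assms in \<open>auto simp: has_field_derivative_def\<close>)

section \<open>A bump function and a smooth step\<close>

text \<open>
  The functions \<open>p (1/t) exp (- 1/t)\<close>, with \<open>p\<close> a polynomial, extended by \<open>0\<close> to \<open>t \<le> 0\<close>: this
  family is closed under differentiation, which is why all of its members are smooth.
\<close>

definition flat :: "real poly \<Rightarrow> real \<Rightarrow> real" where
  "flat p t = (if t > 0 then poly p (1 / t) * exp (- (1 / t)) else 0)"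

lemma poly_times_exp_minus_tendsto_0: "((\<lambda>x::real. poly p x * exp (- x)) \<longlongrightarrow> 0) at_top"
proof -
  have "((\<lambda>x::real. \<Sum>i\<le>degree p. coeff p i * (x ^ i / exp x)) \<longlongrightarrow> (\<Sum>i\<le>degree p. coeff p i * 0)) at_top"
    by (intro tendsto_intros tendsto_power_div_exp_0)
  then show ?thesis
    by (simp add: poly_altdef exp_minus sum_distrib_right divide_inverse mult.assoc)
qed

lemma flat_has_derivative:
  "(flat p has_real_derivative flat ([:0, 0, 1:] * (p - pderiv p)) t) (at t)"
proof -
  consider "t > 0" | "t < 0" | "t = 0" by linarith
  then show ?thesis
  proof cases
    case 1
    have "((\<lambda>t. poly p (1 / t) * exp (- (1 / t))) has_real_derivative
        flat ([:0, 0, 1:] * (p - pderiv p)) t) (at t)"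
      using 1 unfolding flat_def
      by (auto intro!: derivative_eq_intros DERIV_chain'[OF _ poly_DERIV] simp: field_simps power2_eq_square)
    then show ?thesis
      by (rule has_field_derivative_transform_within_open[where S = "{0<..}"])
         (use 1 in \<open>auto simp: flat_def\<close>)
  next
    case 2
    have "((\<lambda>t. 0) has_real_derivative flat ([:0, 0, 1:] * (p - pderiv p)) t) (at t)"
      using 2 by (auto simp: flat_def)
    then show ?thesis
      by (rule has_field_derivative_transform_within_open[where S = "{..<0}"])
         (use 2 in \<open>auto simp: flat_def\<close>)
  next
    case 3
    have right: "((\<lambda>h. flat p h / h) \<longlongrightarrow> 0) (at_right 0)"
    proof -
      have "((\<lambda>h. poly ([:0, 1:] * p) (inverse h) * exp (- inverse h)) \<longlongrightarrow> 0) (at_right (0::real))"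
        by (rule filterlim_compose[OF poly_times_exp_minus_tendsto_0 filterlim_inverse_at_top_right])
      then show ?thesis
        by (rule Lim_transform_eventually)
           (auto simp: eventually_at_filter flat_def field_simps)
    qed
    have left: "((\<lambda>h. flat p h / h) \<longlongrightarrow> 0) (at_left 0)"
      by (rule tendsto_eventually) (auto simp: eventually_at_filter flat_def)
    have "((\<lambda>h. flat p h / h) \<longlongrightarrow> 0) (at 0)"
      using left right by (rule filterlim_split_at)
    then show ?thesis
      using 3 by (simp add: DERIV_def flat_def[of _ 0])
  qed
qed

lemma Ck_flat: "Ck k (flat p)"
proof (induction k arbitrary: p)
  case 0
  show ?case
    by (simp add: continuous_at_imp_continuous_on DERIV_isCont[OF flat_has_derivative])
next
  case (Suc k)
  define q where "q = [:0, 0, 1:] * (p - pderiv p)"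
  have "(flat p has_real_derivative flat q t) (at t)" for t
    unfolding q_def by (rule flat_has_derivative)
  moreover have "Ck k (flat q)"
    by (rule Suc)
  ultimately show ?case
    by (rule Ck_Suc_real)
qed

definition bump :: "real \<Rightarrow> real" where
  "bump t = flat [:1:] (t - 1/4) * flat [:1:] (3/4 - t)"

lemma Ck_bump: "Ck k bump"
  unfolding bump_def[abs_def]
  by (rule Ck_mult; rule Ck_compose[OF Ck_flat]; rule Ck_diff) (rule Ck_const Ck_ident)+

lemma bump_nonneg: "0 \<le> bump t"
  by (simp add: bump_def flat_def)

lemma bump_le_1: "bump t \<le> 1"
proof -
  have "0 \<le> flat [:1:] s \<and> flat [:1:] s \<le> 1" for s by (simp add: flat_def)
  then show ?thesis unfolding bump_def by (simp add: mult_le_one)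
qed

lemma bump_nonzero_iff: "bump t \<noteq> 0 \<longleftrightarrow> 1/4 < t \<and> t < 3/4"
  by (auto simp: bump_def flat_def)

lemma continuous_on_bump: "continuous_on S bump"
  by (rule Ck_continuous_on[OF Ck_bump])

text \<open>
  The lower limit is some point to the left of the support of \<open>bump\<close>.
\<close>

definition step :: "real \<Rightarrow> real" where
  "step t = integral {-1..t} bump"

lemma step_eq_0: "t \<le> 1/4 \<Longrightarrow> step t = 0"
  unfolding step_def by (subst integral_cong[where g = "\<lambda>_. 0"]) (use bump_nonzero_iff in force)+

lemma step_has_derivative: "(step has_real_derivative bump t) (at t)"
proof (cases "t < 0")
  case True
  have "((\<lambda>t. 0) has_real_derivative bump t) (at t)"
    using True bump_nonzero_iff[of t] by auto
  then show ?thesis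
    by (rule has_field_derivative_transform_within_open[where S = "{..<0}"])
       (use True in \<open>auto simp: step_eq_0\<close>)
next
  case False
  have "((\<lambda>u. integral {-1..u} bump) has_real_derivative bump t) (at t within {-1..t+1})"
    by (rule integral_has_real_derivative) (use False in \<open>auto simp: continuous_on_bump\<close>)
  then show ?thesis
    using False at_within_interior[of t "{-1..t+1}"] unfolding step_def by simp
qed

lemma Ck_step: "Ck k step"
proof -
  have "(step has_real_derivative bump t) (at t)" for t
    by (rule step_has_derivative)
  moreover have "Ck k bump"
    by (rule Ck_bump)
  ultimately have "Ck (Suc k) step"
    by (rule Ck_Suc_real)
  then show ?thesis by (rule Ck_Suc_imp_Ck)
qed

lemma continuous_on_step: "continuous_on S step"
  by (rule Ck_continuous_on[OF Ck_step])

lemma step_ge_three_quarters: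
  assumes "3/4 \<le> t" shows "step t = step 1"
proof -
  have "step s = step (3/4)" if "3/4 < s" for s
  proof (rule DERIV_isconst_end[OF that continuous_on_step])
    show "(step has_real_derivative 0) (at x)" if "3/4 < x" for x
      using step_has_derivative[of x] bump_nonzero_iff[of x] that by auto
  qed
  then show ?thesis using assms by (cases "t = 3/4") force+
qed

lemma step_mono: "s \<le> t \<Longrightarrow> step s \<le> step t"
  by (rule DERIV_nonneg_imp_nondecreasing) (use step_has_derivative bump_nonneg in blast)+

lemma step_nonneg: "0 \<le> step t"
  using step_mono[of "min 0 t" t] step_eq_0[of "min 0 t"] by simp

lemma step_1_le_1: "step 1 \<le> 1"
proof -
  obtain z where "step 1 - step 0 = (1 - 0) * bump z"
    using MVT2[of 0 1 step bump] step_has_derivative by auto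
  then show ?thesis using bump_le_1[of z] by (simp add: step_eq_0)
qed

lemma step_le_1: "step t \<le> 1"
  using step_mono[of t "max 1 t"] step_ge_three_quarters[of "max 1 t"] step_1_le_1 by simp

lemma step_1_pos: "0 < step 1"
proof -
  have "step (1/4) < step (3/4)"
  proof (rule DERIV_pos_imp_increasing_open[OF _ _ continuous_on_step])
    show "\<exists>y. (step has_real_derivative y) (at x) \<and> 0 < y" if "1/4 < x" "x < 3/4" for x
      using step_has_derivative[of x] bump_nonzero_iff[of x] bump_nonneg[of x] that
      by (metis less_le)
  qed simp
  then show ?thesis using step_eq_0[of "1/4"] step_ge_three_quarters[of "3/4"] by linarith
qed

section \<open>Weak derivatives\<close>

lemma continuous_compact_support_bounded:
  fixes f :: "'a::euclidean_space \<Rightarrow> real"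
  assumes cont: "continuous_on UNIV f" and K: "compact K" and supp: "\<And>x. x \<notin> K \<Longrightarrow> f x = 0"
  obtains B where "0 \<le> B" "\<And>x. \<bar>f x\<bar> \<le> B"
proof -
  have "compact (f ` K)"
    by (rule compact_continuous_image[OF continuous_on_subset[OF cont] K]) simp
  then obtain B where "\<And>x. x \<in> K \<Longrightarrow> \<bar>f x\<bar> \<le> B"
    using compact_imp_bounded[of "f ` K"] unfolding bounded_iff by auto
  then have "\<bar>f x\<bar> \<le> max 0 B" for x
    using supp[of x] by (cases "x \<in> K") force+
  then show thesis using that[of "max 0 B"] by simp
qed

lemma has_real_derivative_along_line:
  assumes "f differentiable (at (x + s *\<^sub>R \<theta>))"
  shows "((\<lambda>s. f (x + s *\<^sub>R \<theta>)) has_real_derivative frechet_derivative f (at (x + s *\<^sub>R \<theta>)) \<theta>) (at s)"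
proof -
  let ?F = "frechet_derivative f (at (x + s *\<^sub>R \<theta>))"
  have F: "(f has_derivative ?F) (at (x + s *\<^sub>R \<theta>))"
    using assms frechet_derivative_works by blast
  have "((\<lambda>s. x + s *\<^sub>R \<theta>) has_derivative (\<lambda>h. h *\<^sub>R \<theta>)) (at s)"
    by (auto intro!: derivative_eq_intros)
  from has_derivative_compose[OF this F]
  have "((\<lambda>s. f (x + s *\<^sub>R \<theta>)) has_derivative (\<lambda>h. ?F (h *\<^sub>R \<theta>))) (at s)" .
  moreover have "(\<lambda>h. ?F (h *\<^sub>R \<theta>)) = (\<lambda>h. ?F \<theta> * h)"
    using linear_cmul[OF has_derivative_linear[OF F]] by (auto simp: mult.commute)
  ultimately show ?thesis by (simp add: has_field_derivative_def)
qed

lemma lborel_translation: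
  fixes f :: "'a::euclidean_space \<Rightarrow> real"
  assumes [measurable]: "f \<in> borel_measurable borel"
  shows "(\<integral>x. f (x + c) \<partial>lborel) = (\<integral>x. f x \<partial>lborel)"
    and "integrable lborel (\<lambda>x. f (x + c)) \<longleftrightarrow> integrable lborel f"
proof -
  have "(\<integral>x. f x \<partial>distr lborel borel ((+) c)) = (\<integral>x. f (x + c) \<partial>lborel)"
    by (subst integral_distr) (auto simp: add.commute)
  then show "(\<integral>x. f (x + c) \<partial>lborel) = (\<integral>x. f x \<partial>lborel)"
    by (simp add: lborel_distr_plus)
  have "integrable (distr lborel borel ((+) c)) f \<longleftrightarrow> integrable lborel (\<lambda>x. f (x + c))"
    by (subst integrable_distr_eq) (auto simp: add.commute)
  then show "integrable lborel (\<lambda>x. f (x + c)) \<longleftrightarrow> integrable lborel f"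
    by (simp add: lborel_distr_plus)
qed

text \<open>
  The difference quotients of \<open>f\<close> have integral \<open>0\<close> by translation invariance, and they converge
  boundedly to the directional derivative.
\<close>

lemma integral_directional_derivative_eq_0:
  fixes f :: "'a::euclidean_space \<Rightarrow> real"
  assumes diff: "\<And>x. f differentiable (at x)"
    and cont: "continuous_on UNIV (\<lambda>x. frechet_derivative f (at x) \<theta>)"
    and K: "compact K" and supp: "\<And>x. x \<notin> K \<Longrightarrow> f x = 0"
  shows "(\<integral>x. frechet_derivative f (at x) \<theta> \<partial>lborel) = 0"
proof -
  define D where "D x = frechet_derivative f (at x) \<theta>" for x
  define q where "q n x = (f (x + (1 / Suc n) *\<^sub>R \<theta>) - f x) / (1 / Suc n)" for n x
  have line: "((\<lambda>s. f (x + s *\<^sub>R \<theta>)) has_real_derivative D (x + s *\<^sub>R \<theta>)) (at s)" for x s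
    unfolding D_def by (rule has_real_derivative_along_line[OF diff])
  have cf: "continuous_on UNIV f"
    by (simp add: continuous_at_imp_continuous_on differentiable_imp_continuous_within diff)
  obtain r where r: "K \<subseteq> cball 0 r"
    using compact_imp_bounded[OF K] unfolding bounded_iff by (metis mem_cball_0 subsetI)
  have D0: "D x = 0" if "x \<notin> K" for x
  proof -
    have "(f has_derivative (\<lambda>_. 0)) (at x)"
      by (rule has_derivative_transform_within_open[of "\<lambda>_. 0" _ _ _ "- K"])
         (use that supp compact_imp_closed[OF K] in auto)
    then show ?thesis unfolding D_def using frechet_derivative_at by metis
  qed
  obtain L where L: "0 \<le> L" "\<And>x. \<bar>D x\<bar> \<le> L"
    using continuous_compact_support_bounded[OF cont K] D0 unfolding D_def by blast
  have bound: "\<bar>q n x\<bar> \<le> L * indicator (cball 0 (r + norm \<theta>)) x" for n x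
  proof (cases "x \<in> cball 0 (r + norm \<theta>)")
    case True
    obtain z where "f (x + (1 / Suc n) *\<^sub>R \<theta>) - f (x + 0 *\<^sub>R \<theta>) = (1 / Suc n - 0) * D (x + z *\<^sub>R \<theta>)"
      using MVT2[of 0 "1 / Suc n" "\<lambda>s. f (x + s *\<^sub>R \<theta>)", OF _ line] by auto
    then have "q n x = D (x + z *\<^sub>R \<theta>)" by (simp add: q_def)
    then show ?thesis using L(2) True by simp
  next
    case False
    then have x: "norm x > r + norm \<theta>" by (simp add: dist_norm)
    have "norm ((1 / Suc n) *\<^sub>R \<theta>) \<le> norm \<theta>"
      using mult_left_le_one_le[of "norm \<theta>" "1 / Suc n"] by simp
    then have "norm (x + (1 / Suc n) *\<^sub>R \<theta>) > r"
      using x norm_diff_ineq[of x "(1 / Suc n) *\<^sub>R \<theta>"] by linarith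
    moreover have "norm x > r" using x norm_ge_zero[of \<theta>] by linarith
    ultimately have "x + (1 / Suc n) *\<^sub>R \<theta> \<notin> K" "x \<notin> K" using r by auto
    then show ?thesis using False supp by (simp add: q_def)
  qed
  have lim: "(\<lambda>n. q n x) \<longlonglongrightarrow> D x" for x
  proof -
    have "((\<lambda>h. (f (x + h *\<^sub>R \<theta>) - f x) / h) \<longlongrightarrow> D x) (at 0)"
      using line[of x 0] by (simp add: DERIV_def)
    moreover have "filterlim (\<lambda>n. 1 / real (Suc n)) (at 0) sequentially"
      using lim_1_over_n[where 'a = real, THEN LIMSEQ_Suc] by (simp add: filterlim_at)
    ultimately show ?thesis
      unfolding q_def by (rule filterlim_compose)
  qed
  have int_f: "integrable lborel f"
  proof -
    have "integrable lborel (\<lambda>x. indicator K x *\<^sub>R f x)"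
      by (rule borel_integrable_compact[OF K]) (rule continuous_on_subset[OF cf], simp)
    moreover have "(\<lambda>x. indicator K x *\<^sub>R f x) = f" using supp by (force simp: indicator_def)
    ultimately show ?thesis by simp
  qed
  have int_q: "(\<integral>x. q n x \<partial>lborel) = 0" for n
  proof -
    have "integrable lborel (\<lambda>x. f (x + (1 / Suc n) *\<^sub>R \<theta>))"
      using int_f by (subst lborel_translation) (auto intro: borel_measurable_continuous_onI[OF cf])
    then have "(\<integral>x. f (x + (1 / Suc n) *\<^sub>R \<theta>) - f x \<partial>lborel) = 0"
      using int_f borel_measurable_continuous_onI[OF cf] by (simp add: lborel_translation(1))
    then show ?thesis unfolding q_def by (simp only: integral_divide_zero)
  qed
  have "(\<lambda>n. \<integral>x. q n x \<partial>lborel) \<longlonglongrightarrow> (\<integral>x. D x \<partial>lborel)"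
  proof (rule integral_dominated_convergence[where w = "\<lambda>x. L * indicator (cball 0 (r + norm \<theta>)) x"])
    show "D \<in> borel_measurable lborel"
      using borel_measurable_continuous_onI[OF cont] by (simp add: D_def[abs_def])
    have [measurable]: "f \<in> borel_measurable borel"
      by (rule borel_measurable_continuous_onI[OF cf])
    show "q n \<in> borel_measurable lborel" for n
      unfolding q_def by measurable
    show "integrable lborel (\<lambda>x. L * indicator (cball 0 (r + norm \<theta>)) x)"
      by (intro integrable_mult_right integrable_real_indicator emeasure_bounded_finite) auto
  qed (use lim bound in auto)
  then have "(\<integral>x. D x \<partial>lborel) = 0"
    using int_q LIMSEQ_unique[OF _ tendsto_const] by simp
  then show ?thesis by (simp add: D_def)
qed

lemma test_function_support:
  assumes "test_function \<Omega> \<phi>"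
  obtains K where "compact K" "K \<subseteq> \<Omega>" "\<And>x. x \<notin> K \<Longrightarrow> \<phi> x = 0"
    "\<And>x. x \<notin> K \<Longrightarrow> frechet_derivative \<phi> (at x) \<theta> = 0"
proof
  let ?K = "closure {x. \<phi> x \<noteq> 0}"
  show "compact ?K" "?K \<subseteq> \<Omega>" using assms by (auto simp: test_function_def)
  show *: "\<phi> x = 0" if "x \<notin> ?K" for x
    using that closure_subset[of "{x. \<phi> x \<noteq> 0}"] by blast
  show "frechet_derivative \<phi> (at x) \<theta> = 0" if "x \<notin> ?K" for x
  proof -
    have "(\<phi> has_derivative (\<lambda>_. 0)) (at x)"
    proof (rule has_derivative_transform_within_open[of "\<lambda>_. 0" _ _ _ "- ?K"])
      show "0 = \<phi> y" if "y \<in> - ?K" for y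
        using *[of y] that by (metis ComplD)
    qed (use that in \<open>auto simp del: closure_subset\<close>)
    from frechet_derivative_at[OF this] show ?thesis by metis
  qed
qed

lemma test_function_Ck: "test_function \<Omega> \<phi> \<Longrightarrow> Ck k \<phi>"
  by (simp add: test_function_def)

lemma continuous_on_directional_derivative:
  fixes f :: "'a::euclidean_space \<Rightarrow> real"
  assumes "Ck (Suc 0) f"
  shows "continuous_on S (\<lambda>x. frechet_derivative f (at x) \<theta>)"
proof -
  have "frechet_derivative f (at x) \<theta> = (\<Sum>i\<in>Basis. (\<theta> \<bullet> i) * frechet_derivative f (at x) i)" for x
  proof -
    have lin: "linear (frechet_derivative f (at x))"
      using Ck_Suc_imp_has_derivative[OF assms] has_derivative_linear by blast
    have "frechet_derivative f (at x) \<theta> = frechet_derivative f (at x) (\<Sum>i\<in>Basis. (\<theta> \<bullet> i) *\<^sub>R i)"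
      by (simp add: euclidean_representation)
    also have "\<dots> = (\<Sum>i\<in>Basis. (\<theta> \<bullet> i) * frechet_derivative f (at x) i)"
      by (subst linear_sum[OF lin]) (simp add: linear_cmul[OF lin])
    finally show ?thesis .
  qed
  then show ?thesis
    using assms by (auto intro!: continuous_on_sum continuous_on_mult intro: continuous_on_subset)
qed

lemma integral_lebesgue_on_eq_lborel:
  fixes f :: "'a::euclidean_space \<Rightarrow> real"
  assumes "open \<Omega>" and [measurable]: "f \<in> borel_measurable borel" and supp: "\<And>x. x \<notin> \<Omega> \<Longrightarrow> f x = 0"
  shows "(\<integral>x. f x \<partial>lebesgue_on \<Omega>) = (\<integral>x. f x \<partial>lborel)"
proof -
  have "(\<integral>x. f x \<partial>lebesgue_on \<Omega>) = (\<integral>x. indicator \<Omega> x *\<^sub>R f x \<partial>lebesgue)"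
    by (rule integral_restrict_space) (use assms(1) in auto)
  also have "\<dots> = (\<integral>x. f x \<partial>lebesgue)"
    using supp by (intro Bochner_Integration.integral_cong) (auto simp: indicator_def)
  also have "\<dots> = (\<integral>x. f x \<partial>lborel)"
    by (rule integral_completion) simp
  finally show ?thesis .
qed

text \<open>
  The product of \<open>indicator A\<close> with a test function of \<open>\<Omega>\<close> is again smooth with compact support,
  because the interface between \<open>\<Omega> \<inter> A\<close> and \<open>\<Omega> - A\<close> lies outside \<open>\<Omega>\<close>.
\<close>

lemma indicator_is_weak_deriv_0:
  fixes \<Omega> A :: "'a::euclidean_space set"
  assumes op: "open (\<Omega> \<inter> A)" "open (\<Omega> - A)"
  shows "is_weak_deriv \<Omega> \<theta> (indicator A) (\<lambda>_. 0)"
  unfolding is_weak_deriv_def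
proof (intro allI impI)
  fix \<phi> :: "'a \<Rightarrow> real" assume \<phi>: "test_function \<Omega> \<phi>"
  obtain K where K: "compact K" "K \<subseteq> \<Omega>" "\<And>x. x \<notin> K \<Longrightarrow> \<phi> x = 0"
    "\<And>x. x \<notin> K \<Longrightarrow> frechet_derivative \<phi> (at x) \<theta> = 0"
    using test_function_support[OF \<phi>, of \<theta>] by blast
  have "open \<Omega>" using open_Un[OF op] by (simp add: Int_Diff_Un)
  have cover: "(\<Omega> \<inter> A) \<union> (\<Omega> - A) \<union> - K = UNIV" using K(2) by auto
  have opK: "open (- K)" using compact_imp_closed[OF K(1)] by auto
  have deriv_\<phi>: "(\<phi> has_derivative frechet_derivative \<phi> (at x)) (at x)" for x
    using Ck_Suc_imp_has_derivative test_function_Ck[OF \<phi>] by blast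
  let ?f = "\<lambda>x. indicator A x * \<phi> x"
  let ?D = "\<lambda>x. indicator A x * frechet_derivative \<phi> (at x) \<theta>"
  have "(?f has_derivative (\<lambda>h. indicator A x * frechet_derivative \<phi> (at x) h)) (at x)" for x
  proof -
    consider "x \<in> \<Omega> \<inter> A" | "x \<in> \<Omega> - A" | "x \<notin> K" using cover by blast
    then show ?thesis
    proof cases
      case 1
      have "(?f has_derivative frechet_derivative \<phi> (at x)) (at x)"
        by (rule has_derivative_transform_within_open[OF deriv_\<phi> op(1) 1]) auto
      then show ?thesis using 1 by simp
    next
      case 2
      have "(?f has_derivative (\<lambda>_. 0)) (at x)"
        by (rule has_derivative_transform_within_open[OF _ op(2) 2, of "\<lambda>_. 0"]) auto
      then show ?thesis using 2 by simp
    next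
      case 3
      have 0: "((\<lambda>_. 0) has_derivative (\<lambda>_. 0)) (at x)" by simp
      have "(?f has_derivative (\<lambda>_. 0)) (at x)" "(\<phi> has_derivative (\<lambda>_. 0)) (at x)"
        by (rule has_derivative_transform_within_open[OF 0 opK]; use 3 K(3) in simp)+
      moreover from this(2) have "frechet_derivative \<phi> (at x) = (\<lambda>_. 0)"
        using frechet_derivative_at by metis
      ultimately show ?thesis by simp
    qed
  qed
  then have diff: "?f differentiable (at x)"
    and Df: "(\<lambda>h. indicator A x * frechet_derivative \<phi> (at x) h) = frechet_derivative ?f (at x)" for x
    by (auto simp: differentiable_def intro!: frechet_derivative_at)
  have cD: "continuous_on S (\<lambda>x. frechet_derivative \<phi> (at x) \<theta>)" for S
    by (rule continuous_on_directional_derivative[OF test_function_Ck[OF \<phi>]])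
  have "continuous_on (\<Omega> \<inter> A) ?D" "continuous_on (\<Omega> - A) ?D" "continuous_on (- K) ?D"
    using cD K(4) by (simp_all cong: continuous_on_cong_simp)
  then have "continuous_on ((\<Omega> \<inter> A) \<union> (\<Omega> - A) \<union> - K) ?D"
    by (intro continuous_on_open_Un open_Un op opK)
  then have cont: "continuous_on UNIV ?D" by (simp only: cover)
  have "(\<integral>x. frechet_derivative ?f (at x) \<theta> \<partial>lborel) = 0"
    by (rule integral_directional_derivative_eq_0[OF diff _ K(1)])
       (use cont K(3) in \<open>simp_all add: Df[symmetric]\<close>)
  then have "(\<integral>x. ?D x \<partial>lborel) = 0" by (simp add: Df[symmetric])
  moreover have "(\<integral>x. ?D x \<partial>lebesgue_on \<Omega>) = (\<integral>x. ?D x \<partial>lborel)"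
    by (rule integral_lebesgue_on_eq_lborel[OF \<open>open \<Omega>\<close> borel_measurable_continuous_onI[OF cont]])
       (use K(2,4) in auto)
  ultimately show "(\<integral>x. indicator A x * frechet_derivative \<phi> (at x) \<theta> \<partial>lebesgue_on \<Omega>)
      = - (\<integral>x. 0 * \<phi> x \<partial>lebesgue_on \<Omega>)" by simp
qed

lemma finite_measure_lebesgue_on_bounded_open:
  "open \<Omega> \<Longrightarrow> bounded \<Omega> \<Longrightarrow> finite_measure (lebesgue_on \<Omega>)"
  by (intro finite_measure_lebesgue_on lmeasurable_open)

text \<open>
  Direction and dimension are arbitrary, because this is needed for all directions in the plane as well as
  for the slices of the domain by lines.
\<close>

lemma indicator_mem_W:
  fixes \<Omega> A :: "'a::euclidean_space set"
  assumes "bounded \<Omega>" "open (\<Omega> \<inter> A)" "open (\<Omega> - A)"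
  shows "indicator A \<in> W \<theta> \<Omega>"
proof -
  have "open \<Omega>" using open_Un[OF assms(2,3)] by (simp add: Int_Diff_Un)
  interpret finite_measure "lebesgue_on \<Omega>"
    using \<open>open \<Omega>\<close> assms(1) by (rule finite_measure_lebesgue_on_bounded_open)
  have meas: "(indicator A :: 'a \<Rightarrow> real) \<in> borel_measurable (lebesgue_on \<Omega>)"
  proof -
    have "(indicator (\<Omega> \<inter> A) :: 'a \<Rightarrow> real) \<in> borel_measurable (lebesgue_on \<Omega>)"
      using assms(2) by (intro measurable_restrict_space1 borel_measurable_indicator) auto
    then show ?thesis
      by (rule measurable_cong[THEN iffD1, rotated]) (auto simp: indicator_def)
  qed
  have "integrable (lebesgue_on \<Omega>) (\<lambda>x. (indicator A x :: real)\<^sup>2)"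
    using meas by (intro integrable_const_bound[where B = 1] borel_measurable_power AE_I2)
                  (auto split: split_indicator)
  then have "square_integrable (lebesgue_on \<Omega>) (indicator A)"
    using meas by (simp add: square_integrable_def)
  moreover have "square_integrable (lebesgue_on \<Omega>) (\<lambda>_. 0)"
    by (simp add: square_integrable_def)
  ultimately show ?thesis
    using indicator_is_weak_deriv_0[OF assms(2,3)] unfolding W_def by blast
qed

text \<open>
  On a finite measure space \<open>\<bar>f\<bar> \<le> f\<^sup>2 + 1\<close> is integrable.
\<close>

lemma (in finite_measure) integrable_square_integrable_mult:
  assumes f: "square_integrable M f" and [measurable]: "g \<in> borel_measurable M"
    and g: "\<And>x. x \<in> space M \<Longrightarrow> \<bar>g x\<bar> \<le> B"
  shows "integrable M (\<lambda>x. f x * g x)"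
proof (rule Bochner_Integration.integrable_bound)
  have [measurable]: "f \<in> borel_measurable M" using f by (simp add: square_integrable_def)
  show "integrable M (\<lambda>x. ((f x)\<^sup>2 + 1) * \<bar>B\<bar>)"
    using f by (intro integrable_mult_left Bochner_Integration.integrable_add)
               (auto simp: square_integrable_def)
  show "(\<lambda>x. f x * g x) \<in> borel_measurable M" by measurable
  show "AE x in M. norm (f x * g x) \<le> norm (((f x)\<^sup>2 + 1) * \<bar>B\<bar>)"
  proof (rule AE_I2)
    fix x assume "x \<in> space M"
    have "\<bar>f x\<bar> \<le> (f x)\<^sup>2 + 1"
      using zero_le_power2[of "\<bar>f x\<bar> - 1"] by (simp add: power2_eq_square algebra_simps)
    moreover have "\<bar>g x\<bar> \<le> \<bar>B\<bar>" using g[OF \<open>x \<in> space M\<close>] by linarith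
    ultimately have "\<bar>f x\<bar> * \<bar>g x\<bar> \<le> ((f x)\<^sup>2 + 1) * \<bar>B\<bar>"
      by (intro mult_mono) auto
    then show "norm (f x * g x) \<le> norm (((f x)\<^sup>2 + 1) * \<bar>B\<bar>)"
      by (simp add: abs_mult)
  qed
qed

lemma square_integrable_diff:
  assumes "square_integrable M f" "square_integrable M g"
  shows "square_integrable M (\<lambda>x. f x - g x)"
proof -
  have [measurable]: "f \<in> borel_measurable M" "g \<in> borel_measurable M"
    and int: "integrable M (\<lambda>x. (f x)\<^sup>2)" "integrable M (\<lambda>x. (g x)\<^sup>2)"
    using assms by (auto simp: square_integrable_def)
  have "integrable M (\<lambda>x. (f x - g x)\<^sup>2)"
  proof (rule Bochner_Integration.integrable_bound)
    show "integrable M (\<lambda>x. 2 * (f x)\<^sup>2 + 2 * (g x)\<^sup>2)" using int by simp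
    have "(a - b)\<^sup>2 \<le> 2 * a\<^sup>2 + 2 * b\<^sup>2" for a b :: real
      using zero_le_power2[of "a + b"] by (simp add: power2_eq_square algebra_simps)
    then show "AE x in M. norm ((f x - g x)\<^sup>2) \<le> norm (2 * (f x)\<^sup>2 + 2 * (g x)\<^sup>2)"
      by auto
  qed measurable
  then show ?thesis by (simp add: square_integrable_def)
qed

lemma W_diff:
  fixes \<Omega> :: "'a::euclidean_space set"
  assumes "open \<Omega>" "bounded \<Omega>" and u: "u \<in> W \<theta> \<Omega>" and v: "v \<in> W \<theta> \<Omega>"
  shows "(\<lambda>x. u x - v x) \<in> W \<theta> \<Omega>"
proof -
  interpret finite_measure "lebesgue_on \<Omega>"
    using assms(1,2) by (rule finite_measure_lebesgue_on_bounded_open)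
  obtain u' v' where sq: "square_integrable (lebesgue_on \<Omega>) u" "square_integrable (lebesgue_on \<Omega>) v"
      "square_integrable (lebesgue_on \<Omega>) u'" "square_integrable (lebesgue_on \<Omega>) v'"
    and wd: "is_weak_deriv \<Omega> \<theta> u u'" "is_weak_deriv \<Omega> \<theta> v v'"
    using u v by (auto simp: W_def)
  have "is_weak_deriv \<Omega> \<theta> (\<lambda>x. u x - v x) (\<lambda>x. u' x - v' x)"
    unfolding is_weak_deriv_def
  proof (intro allI impI)
    fix \<phi> :: "'a \<Rightarrow> real" assume \<phi>: "test_function \<Omega> \<phi>"
    let ?D = "\<lambda>x. frechet_derivative \<phi> (at x) \<theta>"
    obtain K where K: "compact K" "K \<subseteq> \<Omega>" "\<And>x. x \<notin> K \<Longrightarrow> \<phi> x = 0" "\<And>x. x \<notin> K \<Longrightarrow> ?D x = 0"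
      by (rule test_function_support[OF \<phi>, of \<theta>]) (rule that)
    have cont: "continuous_on UNIV \<phi>" "continuous_on UNIV ?D"
      using Ck_continuous_on[OF test_function_Ck[OF \<phi>]]
        continuous_on_directional_derivative[OF test_function_Ck[OF \<phi>]] by simp_all
    obtain B1 where B1: "\<And>x. \<bar>\<phi> x\<bar> \<le> B1"
      using continuous_compact_support_bounded[OF cont(1) K(1,3)] by blast
    obtain B2 where B2: "\<And>x. \<bar>?D x\<bar> \<le> B2"
      using continuous_compact_support_bounded[OF cont(2) K(1,4)] by blast
    have meas: "\<phi> \<in> borel_measurable (lebesgue_on \<Omega>)" "?D \<in> borel_measurable (lebesgue_on \<Omega>)"
      using cont[THEN borel_measurable_continuous_onI]
      by (intro measurable_restrict_space1 measurable_completion; simp)+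
    have "integrable (lebesgue_on \<Omega>) (\<lambda>x. f x * ?D x)" "integrable (lebesgue_on \<Omega>) (\<lambda>x. f x * \<phi> x)"
      if "square_integrable (lebesgue_on \<Omega>) f" for f
      using integrable_square_integrable_mult[OF that meas(1), of B1]
        integrable_square_integrable_mult[OF that meas(2), of B2] B1 B2 by auto
    then show "(\<integral>x. (u x - v x) * ?D x \<partial>lebesgue_on \<Omega>) = - (\<integral>x. (u' x - v' x) * \<phi> x \<partial>lebesgue_on \<Omega>)"
      using sq wd \<phi> by (simp add: left_diff_distrib is_weak_deriv_def)
  qed
  then show ?thesis
    using sq square_integrable_diff unfolding W_def by blast
qed

section \<open>The domain\<close>

text \<open>
  The parabola \<open>foot x = c\<close> meets the horizontal axis in the point \<open>c\<close>.
\<close>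

definition foot :: "real^2 \<Rightarrow> real" where
  "foot x = x$1 - (x$2)\<^sup>2"

text \<open>
  The arcs are continued downwards across the axis to make the set closed; the domain excludes only the
  points above the axis.
\<close>

definition slit :: "nat \<Rightarrow> (real^2) set" where
  "slit n = {x. x$2 \<le> (1/2)^n \<and> 8^n * foot x \<in> \<int>}"

definition upper_half :: "(real^2) set" where
  "upper_half = {x. 0 < x$2}"

definition comb_domain :: "(real^2) set" where
  "comb_domain = {x. 0 < foot x \<and> foot x < 1 \<and> \<bar>x$2\<bar> < 1 \<and> x$2 \<noteq> 0 \<and>
     (0 < x$2 \<longrightarrow> (\<forall>n. x \<notin> slit n))}"

lemma continuous_on_foot [continuous_intros]:
  "continuous_on S f \<Longrightarrow> continuous_on S (\<lambda>x. foot (f x))"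
  unfolding foot_def by (intro continuous_intros)

lemma closed_slit: "closed (slit n)"
proof -
  have "closed ((\<lambda>x. 8^n * foot x) -` \<int>)"
    by (intro closed_vimage closed_Ints continuous_intros)
  moreover have "closed {x::real^2. x$2 \<le> (1/2)^n}"
    by (intro closed_Collect_le continuous_intros)
  ultimately have "closed ((\<lambda>x. 8^n * foot x) -` \<int> \<inter> {x. x$2 \<le> (1/2)^n})"
    by (rule closed_Int)
  moreover have "(\<lambda>x. 8^n * foot x) -` \<int> \<inter> {x. x$2 \<le> (1/2)^n} = slit n"
    by (auto simp: slit_def)
  ultimately show ?thesis by simp
qed

lemma open_comb_below: "open (comb_domain - upper_half)"
proof -
  have "comb_domain - upper_half = {x. 0 < foot x} \<inter> {x. foot x < 1} \<inter> {x. -1 < x$2} \<inter> {x. x$2 < 0}"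
    by (auto simp: comb_domain_def upper_half_def)
  then show ?thesis
    by (auto intro!: open_Int open_Collect_less continuous_intros)
qed

text \<open>Only finitely many of the slits reach up to a given positive height.\<close>

lemma open_comb_above: "open (comb_domain \<inter> upper_half)"
proof -
  define strip where "strip N = {x::real^2. (1/2)^N < x$2} \<inter> {x. x$2 < 1} \<inter>
    {x. 0 < foot x} \<inter> {x. foot x < 1} \<inter> (\<Inter>n<N. - slit n)" for N
  have "comb_domain \<inter> upper_half = (\<Union>N. strip N)"
  proof (intro equalityI subsetI)
    fix x assume x: "x \<in> comb_domain \<inter> upper_half"
    then obtain N where "(1/2)^N < x$2"
      using real_arch_pow_inv[of "x$2" "1/2"] by (auto simp: upper_half_def)
    then have "x \<in> strip N"
      using x by (auto simp: strip_def comb_domain_def upper_half_def)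
    then show "x \<in> (\<Union>N. strip N)" by blast
  next
    fix x assume "x \<in> (\<Union>N. strip N)"
    then obtain N where x: "x \<in> strip N" by blast
    then have N: "(1/2)^N < x$2" by (simp add: strip_def)
    have pos: "0 < x$2" by (rule le_less_trans[OF _ N]) simp
    have "x \<notin> slit n" for n
    proof (cases "n < N")
      case True
      then show ?thesis using x by (auto simp: strip_def)
    next
      case False
      then have "(1/2::real)^n \<le> (1/2)^N" by (intro power_decreasing) auto
      then have "(1/2)^n < x$2" using N by (rule le_less_trans)
      then show ?thesis by (simp add: slit_def)
    qed
    then show "x \<in> comb_domain \<inter> upper_half"
      using x pos by (auto simp: strip_def comb_domain_def upper_half_def)
  qed
  moreover have "open (strip N)" for N
    unfolding strip_def
    by (intro open_Int open_Collect_less open_INT continuous_intros) (auto simp: open_Compl closed_slit)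
  ultimately show ?thesis by auto
qed

lemma open_comb: "open comb_domain"
  using open_Un[OF open_comb_above open_comb_below] by (simp add: Int_Diff_Un)

lemma bounded_comb: "bounded comb_domain"
  unfolding bounded_iff
proof (intro exI ballI)
  fix x assume x: "x \<in> comb_domain"
  have "(x$2)\<^sup>2 \<le> 1" using x by (simp add: comb_domain_def abs_square_le_1)
  moreover have "(x$2)\<^sup>2 < x$1" "x$1 - (x$2)\<^sup>2 < 1" "\<bar>x$2\<bar> < 1"
    using x by (auto simp: comb_domain_def foot_def)
  ultimately have "\<bar>x$1\<bar> \<le> 2" "\<bar>x$2\<bar> \<le> 1"
    using zero_le_power2[of "x$2"] by linarith+
  then show "norm x \<le> 3" using norm_le_l1_cart[of x] by (simp add: sum_2)
qed

section \<open>The indicator of the upper half plane and its directional traces\<close>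

text \<open>
  On a straight line \<open>foot\<close> is a quadratic, so between the axis and height \<open>q = (1/2)^n\<close> it varies by
  at least \<open>q\<^sup>2\<close> once \<open>q\<close> is small. This exceeds the distance \<open>q\<^sup>3 = (1/8)^n\<close> between the \<open>n\<close>-th slits,
  so that the line crosses one of them.
\<close>

lemma line_to_axis_crosses_slit:
  assumes "0 < T" and line: "\<And>t. 0 < t \<Longrightarrow> t < T \<Longrightarrow> p t $ 1 = a + m * t \<and> p t $ 2 = t"
  shows "\<exists>t n. 0 < t \<and> t < T \<and> p t \<in> slit n"
proof -
  \<comment> \<open>the bound by \<open>\<bar>m\<bar> / 2\<close> yields \<open>q \<le> \<bar>m - q\<bar>\<close> for slanted lines; for \<open>m = 0\<close> this is trivial\<close>
  define r where "r = min T (min 1 (if m = 0 then 1 else \<bar>m\<bar> / 2))"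
  have "0 < r" using assms(1) by (simp add: r_def)
  then obtain n where n: "(1/2)^n < r" using real_arch_pow_inv[of r "1/2"] by auto
  define q :: real where "q = (1/2)^n"
  have q: "0 < q" "q < T" "q < 1" and qm: "m = 0 \<or> 2 * q < \<bar>m\<bar>"
    using n by (auto simp: q_def r_def split: if_splits)
  have q3: "8^n * q^3 = 1"
    by (simp add: q_def power_mult[symmetric] mult.commute[of n] power_mult power_mult_distrib[symmetric] power_divide)
  define f where "f t = 8^n * (a + m * t - t\<^sup>2)" for t
  have "q \<le> \<bar>m - q\<bar>" using q qm by auto
  then have "q * q \<le> q * \<bar>m - q\<bar>" using q by (intro mult_left_mono) auto
  also have "\<dots> = \<bar>m * q - q\<^sup>2\<bar>" using q by (simp add: abs_mult_pos' power2_eq_square algebra_simps abs_mult)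
  finally have "q * q \<le> \<bar>m * q - q\<^sup>2\<bar>" .
  moreover have "q^3 < q * q"
    using q mult_strict_right_mono[of q 1 "q * q"] by (simp add: power3_eq_cube)
  ultimately have "q^3 < \<bar>m * q - q\<^sup>2\<bar>" by linarith
  then have "8^n * q^3 < 8^n * \<bar>m * q - q\<^sup>2\<bar>" by simp
  then have gap: "1 < \<bar>f q - f 0\<bar>"
    unfolding q3 f_def by (simp add: right_diff_distrib[symmetric] abs_mult)
  \<comment> \<open>an integer strictly between \<open>f 0\<close> and \<open>f q\<close>, hence attained at some \<open>t \<noteq> 0\<close>\<close>
  define k where "k = \<lfloor>min (f 0) (f q)\<rfloor> + 1"
  have k: "min (f 0) (f q) < of_int k" "of_int k < max (f 0) (f q)"
    using gap floor_correct[of "min (f 0) (f q)"] unfolding k_def of_int_add of_int_1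
    by linarith+
  have cont: "continuous_on {0..q} f" unfolding f_def by (intro continuous_intros)
  have "\<exists>t. 0 \<le> t \<and> t \<le> q \<and> f t = of_int k"
  proof (cases "f 0 \<le> f q")
    case True
    then show ?thesis using IVT'[of f 0 "of_int k" q] k cont q by auto
  next
    case False
    then show ?thesis using IVT2'[of f q "of_int k" 0] k cont q by auto
  qed
  then obtain t where t: "0 \<le> t" "t \<le> q" "f t = of_int k" by blast
  have "t \<noteq> 0" using t k gap by (auto simp: min_def max_def split: if_splits)
  then have "0 < t" "t < T" using t q by auto
  moreover have "p t \<in> slit n"
    using t line[OF \<open>0 < t\<close> \<open>t < T\<close>] by (simp add: slit_def foot_def q_def f_def)
  ultimately show ?thesis by blast
qed

text \<open>
  If the segment ended on the axis, then its height would serve as a parameter for it near the end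
  point, and it would have to cross a slit.
\<close>

lemma segment_exits_above_axis:
  assumes "\<alpha> < \<beta>" and seg: "\<And>s. \<alpha> < s \<Longrightarrow> s < \<beta> \<Longrightarrow> s *\<^sub>R \<theta> + y \<in> comb_domain \<inter> upper_half"
  shows "\<beta> *\<^sub>R \<theta> + y \<in> upper_half"
proof (rule ccontr)
  assume "\<beta> *\<^sub>R \<theta> + y \<notin> upper_half"
  then have le: "\<beta> * \<theta>$2 + y$2 \<le> 0" by (simp add: upper_half_def)
  have pos: "0 < s * \<theta>$2 + y$2" if "\<alpha> < s" "s < \<beta>" for s
    using seg[OF that] by (simp add: upper_half_def)
  have neg: "\<theta>$2 < 0"
  proof -
    have "(\<beta> - (\<alpha> + \<beta>) / 2) * \<theta>$2 < 0"
      using pos[of "(\<alpha> + \<beta>) / 2"] le assms(1) by (simp add: left_diff_distrib)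
    then show ?thesis using assms(1) by (simp add: mult_less_0_iff)
  qed
  have eq: "\<beta> * \<theta>$2 + y$2 = 0"
  proof (rule ccontr)
    \<comment> \<open>otherwise the height is already nonpositive slightly before \<open>\<beta>\<close>\<close>
    define e where "e = min ((\<beta> - \<alpha>) / 2) ((\<beta> * \<theta>$2 + y$2) / \<theta>$2)"
    assume "\<beta> * \<theta>$2 + y$2 \<noteq> 0"
    then have "0 < e" using le neg assms(1) by (auto simp: e_def divide_neg_neg)
    moreover have "e \<le> (\<beta> - \<alpha>) / 2" unfolding e_def by (rule min.cobounded1)
    then have "e < \<beta> - \<alpha>" using assms(1) by (simp add: field_simps)
    moreover have "e \<le> (\<beta> * \<theta>$2 + y$2) / \<theta>$2" by (simp add: e_def)
    then have "\<beta> * \<theta>$2 + y$2 \<le> e * \<theta>$2" using neg by (simp add: neg_le_divide_eq)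
    ultimately show False using pos[of "\<beta> - e"] by (simp add: algebra_simps)
  qed
  \<comment> \<open>the line parametrized by its height\<close>
  define p where "p t = (\<beta> + t / \<theta>$2) *\<^sub>R \<theta> + y" for t
  define T where "T = (\<alpha> - \<beta>) * \<theta>$2"
  have "0 < T" using assms(1) neg by (simp add: T_def mult_neg_neg)
  moreover have "p t $ 1 = (\<beta> * \<theta>$1 + y$1) + (\<theta>$1 / \<theta>$2) * t \<and> p t $ 2 = t" for t
    using neg eq by (simp add: p_def distrib_right)
  ultimately obtain t n where t: "0 < t" "t < T" "p t \<in> slit n"
    using line_to_axis_crosses_slit[of T p] by blast
  have "\<alpha> < \<beta> + t / \<theta>$2" "\<beta> + t / \<theta>$2 < \<beta>"
    using t neg by (auto simp: T_def field_simps)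
  then have "p t \<in> comb_domain \<inter> upper_half" unfolding p_def by (rule seg)
  then show False using t(3) by (auto simp: comb_domain_def upper_half_def)
qed

text \<open>
  The domain avoids the axis, so a segment in it stays on one side; its end point cannot reach the axis
  from above, and ending on the axis from below counts as being below.
\<close>

lemma segment_in_comb_one_side:
  assumes seg: "\<And>s. \<alpha> < s \<Longrightarrow> s < \<beta> \<Longrightarrow> s *\<^sub>R \<theta> + y \<in> comb_domain" and s: "\<alpha> < s" "s < \<beta>"
  shows "s *\<^sub>R \<theta> + y \<in> upper_half \<longleftrightarrow> \<beta> *\<^sub>R \<theta> + y \<in> upper_half"
proof -
  let ?h = "\<lambda>s. s * \<theta>$2 + y$2"
  have nz: "?h t \<noteq> 0" if "\<alpha> < t" "t < \<beta>" for t
    using seg[OF that] by (simp add: comb_domain_def)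
  have cont: "continuous_on A ?h" for A by (intro continuous_intros)
  have same: "0 < ?h t \<longleftrightarrow> 0 < ?h s" if t: "\<alpha> < t" "t < \<beta>" for t
  proof (rule ccontr)
    assume *: "\<not> ?thesis"
    have "is_interval (?h ` {\<alpha><..<\<beta>})"
      by (intro is_interval_connected_1[THEN iffD2] connected_continuous_image cont) simp
    then have "0 \<in> ?h ` {\<alpha><..<\<beta>}"
      using * t s nz[OF t] nz[OF s] unfolding is_interval_1
      by (smt (verit) greaterThanLessThan_iff image_eqI)
    then show False using nz by auto
  qed
  show ?thesis
  proof (cases "0 < ?h s")
    case True
    have "t *\<^sub>R \<theta> + y \<in> comb_domain \<inter> upper_half" if "\<alpha> < t" "t < \<beta>" for t
      using seg[OF that] same[OF that] True by (simp add: upper_half_def)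
    from segment_exits_above_axis[OF _ this] show ?thesis
      using True s by (auto simp: upper_half_def)
  next
    case False
    have "?h \<beta> \<le> 0"
    proof (rule tendsto_upperbound)
      show "(?h \<longlongrightarrow> ?h \<beta>) (at_left \<beta>)" by (intro tendsto_intros)
      show "\<forall>\<^sub>F t in at_left \<beta>. ?h t \<le> 0"
        using eventually_at_left_real[of \<alpha> \<beta>] s by (auto elim!: eventually_mono simp: not_less[symmetric] same False)
    qed simp
    then show ?thesis using False by (simp add: upper_half_def)
  qed
qed

text \<open>
  On each component of every slice the function is constant and equal to its value at the end point, so
  all lines qualify.
\<close>

lemma indicator_upper_half_directional_trace:
  assumes "norm \<theta> = 1"
  shows "directional_trace comb_domain \<theta> (indicator upper_half) (indicator upper_half)"
  unfolding directional_trace_def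
proof (intro conjI exI ballI allI impI)
  let ?u = "indicator upper_half :: real^2 \<Rightarrow> real"
  show "?u \<in> W \<theta> comb_domain"
    by (rule indicator_mem_W[OF bounded_comb open_comb_above open_comb_below])
  show "AE x in lebesgue_on comb_domain. ?u x = ?u x" by simp
  show "proj_perp \<theta> ` comb_domain \<subseteq> proj_perp \<theta> ` comb_domain" by simp
  show "proj_perp \<theta> ` comb_domain - proj_perp \<theta> ` comb_domain \<in> null_sets (lebesgue_perp \<theta>)" by simp
  fix y
  let ?L = "line_slice comb_domain \<theta> y" and ?p = "\<lambda>s. s *\<^sub>R \<theta> + y"
  have L: "?L = ?p -` comb_domain" by (auto simp: line_slice_def)
  have open_pre: "open (?p -` S)" if "open S" for S
    by (rule open_vimage[OF that]) (intro continuous_intros)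
  show "(\<lambda>s. ?u (s *\<^sub>R \<theta> + y)) \<in> H1 ?L"
  proof -
    have "bounded ?L"
    proof -
      obtain B where B: "\<And>x. x \<in> comb_domain \<Longrightarrow> norm x \<le> B"
        using bounded_comb by (auto simp: bounded_iff)
      have "\<bar>s\<bar> \<le> B + norm y" if "s \<in> ?L" for s
      proof -
        have "\<bar>s\<bar> = norm (?p s - y)" using assms by simp
        also have "\<dots> \<le> norm (?p s) + norm y" by (rule norm_triangle_ineq4)
        also have "\<dots> \<le> B + norm y" using B that by (simp add: L)
        finally show ?thesis .
      qed
      then show ?thesis unfolding bounded_iff by (auto intro!: exI[of _ "B + norm y"])
    qed
    moreover have "open (?L \<inter> ?p -` upper_half)" "open (?L - ?p -` upper_half)"
      using open_pre[OF open_comb_above] open_pre[OF open_comb_below] by (simp_all add: L vimage_Int vimage_Diff)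
    ultimately have "indicator (?p -` upper_half) \<in> W i ?L" for i
      by (rule indicator_mem_W)
    moreover have "(\<lambda>s. ?u (s *\<^sub>R \<theta> + y)) = indicator (?p -` upper_half)"
      by (auto simp: indicator_def)
    ultimately show ?thesis by (simp add: H1_def)
  qed
  fix \<alpha> \<beta> assume comp: "{\<alpha><..<\<beta>} \<in> components ?L"
  have "{\<alpha><..<\<beta>} \<subseteq> ?L" using in_components_subset[OF comp] .
  then have seg: "?p s \<in> comb_domain" if "\<alpha> < s" "s < \<beta>" for s
    using that by (auto simp: L)
  show "AE s in lebesgue_on {\<alpha><..<\<beta>}. ?u (\<beta> *\<^sub>R \<theta> + y) = ?u (s *\<^sub>R \<theta> + y)"
    by (rule AE_I2) (use segment_in_comb_one_side[OF seg] in \<open>auto simp: indicator_def\<close>)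
qed auto

section \<open>Total mass of the directional measures\<close>

text \<open>
  The measure \<open>distr M N f\<close> is given by the preimages under \<open>f\<close>, or is null in case these do not define a
  measure.
\<close>

lemma emeasure_distr_le: "emeasure (distr M N f) A \<le> emeasure M (space M)"
  unfolding distr_def by (auto simp: emeasure_measure_of_conv intro: emeasure_space)

lemma dir_measure_mass_le:
  assumes "open \<Omega>" "bounded \<Omega>"
  shows "finite_measure (dir_measure \<Omega> \<theta>)"
    and "measure (dir_measure \<Omega> \<theta>) (space (dir_measure \<Omega> \<theta>)) \<le> measure (lebesgue_on \<Omega>) (space (lebesgue_on \<Omega>))"
proof -
  interpret \<Omega>: finite_measure "lebesgue_on \<Omega>"
    using assms by (rule finite_measure_lebesgue_on_bounded_open)
  have le: "emeasure (dir_measure \<Omega> \<theta>) A \<le> emeasure (lebesgue_on \<Omega>) (space (lebesgue_on \<Omega>))" for A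
    unfolding dir_measure_def by (rule emeasure_distr_le)
  show "finite_measure (dir_measure \<Omega> \<theta>)"
    using le[of "space (dir_measure \<Omega> \<theta>)"] \<Omega>.emeasure_finite
    by (intro finite_measureI) (metis top_unique infinity_ennreal_def)
  show "measure (dir_measure \<Omega> \<theta>) (space (dir_measure \<Omega> \<theta>)) \<le> measure (lebesgue_on \<Omega>) (space (lebesgue_on \<Omega>))"
    unfolding measure_def using \<Omega>.emeasure_finite[of "space (lebesgue_on \<Omega>)"]
    by (intro enn2real_mono le) (metis top.not_eq_extremum infinity_ennreal_def)
qed

lemma indicator_in_L2_boundary:
  assumes "open \<Omega>" "bounded \<Omega>" "A \<in> sets borel"
  shows "indicator A \<in> L2_boundary \<Omega>"
  unfolding L2_boundary_def
proof (intro CollectI exI conjI ballI)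
  let ?m = "measure (lebesgue_on \<Omega>) (space (lebesgue_on \<Omega>))"
  show "0 \<le> ?m" by simp
  fix \<theta> :: 'a
  interpret finite_measure "dir_measure \<Omega> \<theta>"
    by (rule dir_measure_mass_le[OF assms(1,2)])
  have meas [measurable]: "(indicator A :: 'a \<Rightarrow> real) \<in> borel_measurable (dir_measure \<Omega> \<theta>)"
    unfolding dir_measure_def using assms(3) by (simp add: measurable_restrict_space1)
  have int: "integrable (dir_measure \<Omega> \<theta>) (\<lambda>x. (indicator A x :: real)\<^sup>2)"
    by (intro integrable_const_bound[where B = 1] AE_I2) (auto split: split_indicator)
  then show "square_integrable (dir_measure \<Omega> \<theta>) (indicator A)"
    using meas by (simp add: square_integrable_def)
  show "AE z in dir_measure \<Omega> \<theta>. indicator A z = (indicator A z :: real)" by simp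
  have "(\<integral>z. (indicator A z :: real)\<^sup>2 \<partial>dir_measure \<Omega> \<theta>) \<le> (\<integral>z. 1 \<partial>dir_measure \<Omega> \<theta>)"
    by (intro integral_mono int) (auto split: split_indicator)
  also have "\<dots> \<le> ?m" using dir_measure_mass_le(2)[OF assms(1,2)] by simp
  finally show "(\<integral>z. (indicator A z :: real)\<^sup>2 \<partial>dir_measure \<Omega> \<theta>) \<le> ?m" .
qed

lemma indicator_upper_half_in_H1_tr: "indicator upper_half \<in> H1_tr comb_domain"
  unfolding H1_tr_def
proof (intro CollectI conjI bexI ballI)
  show "indicator upper_half \<in> H1 comb_domain"
    unfolding H1_def using indicator_mem_W[OF bounded_comb open_comb_above open_comb_below] by blast
  show "indicator upper_half \<in> L2_boundary comb_domain"
    by (rule indicator_in_L2_boundary[OF open_comb bounded_comb])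
       (auto simp: upper_half_def intro!: borel_open open_Collect_less continuous_intros)
  show "indicator upper_half \<in> gamma comb_domain \<theta> (indicator upper_half)" if "\<theta> \<in> sphere 0 1" for \<theta>
    unfolding gamma_def using indicator_upper_half_directional_trace that by simp
qed simp

section \<open>Iterated integrals and reflections in the plane\<close>

lemma Basis_real2: "(Basis :: (real^2) set) = {axis 1 1, axis 2 1}"
  by (auto simp: Basis_vec_def UNIV_2)

lemma axis_real2 [simp]: "(axis 1 a :: real^2) $ 2 = 0" "(axis 2 a :: real^2) $ 1 = 0"
  by (simp_all add: axis_def)

lemma nn_integral_real2:
  fixes f :: "real^2 \<Rightarrow> ennreal"
  assumes [measurable]: "f \<in> borel_measurable borel"
  shows "(\<integral>\<^sup>+x. f x \<partial>lborel) =
    (\<integral>\<^sup>+t. \<integral>\<^sup>+s. f (s *\<^sub>R axis 1 1 + t *\<^sub>R axis 2 1) \<partial>lborel \<partial>lborel)"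
proof -
  define P :: "real \<times> real \<Rightarrow> real^2" where "P = (\<lambda>p. fst p *\<^sub>R axis 1 1 + snd p *\<^sub>R axis 2 1)"
  have [measurable]: "P \<in> borel \<rightarrow>\<^sub>M borel"
    unfolding P_def by (intro borel_measurable_continuous_onI continuous_intros)
  have "lborel = distr lborel borel P"
  proof (rule lborel_eqI)
    fix l u :: "real^2" assume le: "\<And>b. b \<in> Basis \<Longrightarrow> l \<bullet> b \<le> u \<bullet> b"
    have "P -` box l u = box (l$1, l$2) (u$1, u$2)"
      by (auto simp: P_def mem_box Basis_real2 Basis_prod_def inner_axis)
    moreover have "\<forall>b\<in>Basis. (l$1, l$2) \<bullet> b \<le> (u$1, u$2) \<bullet> b"
      using le[of "axis 1 1"] le[of "axis 2 1"] by (auto simp: Basis_real2 Basis_prod_def inner_axis)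
    ultimately show "emeasure (distr lborel borel P) (box l u) = (\<Prod>b\<in>Basis. (u - l) \<bullet> b)"
      by (simp add: emeasure_distr emeasure_lborel_box_eq Basis_real2 Basis_prod_def inner_axis
          axis_eq_axis prod.union_disjoint)
  qed simp
  then have "(\<integral>\<^sup>+x. f x \<partial>lborel) = (\<integral>\<^sup>+x. f x \<partial>distr lborel borel P)" by simp
  also have "\<dots> = (\<integral>\<^sup>+p. f (P p) \<partial>lborel)"
    by (rule nn_integral_distr) auto
  also have "\<dots> = (\<integral>\<^sup>+p. f (P p) \<partial>(lborel \<Otimes>\<^sub>M lborel))"
    by (simp only: lborel_prod)
  also have "\<dots> = (\<integral>\<^sup>+t. \<integral>\<^sup>+s. f (P (s, t)) \<partial>lborel \<partial>lborel)"
    by (rule lborel_pair.nn_integral_snd[symmetric]) (simp add: lborel_prod)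
  finally show ?thesis by (simp add: P_def)
qed

definition mirror :: "real^2 \<Rightarrow> real^2" where
  "mirror x = x - (2 * x$2) *\<^sub>R axis 2 1"

lemma mirror_nth [simp]: "mirror x $ 1 = x $ 1" "mirror x $ 2 = - x $ 2"
  by (simp_all add: mirror_def)

lemma mirror_mirror [simp]: "mirror (mirror x) = x"
  by (simp add: vec_eq_iff forall_2)

lemma foot_mirror [simp]: "foot (mirror x) = foot x"
  by (simp add: foot_def)

lemma measurable_mirror [measurable]: "mirror \<in> borel \<rightarrow>\<^sub>M borel"
  unfolding mirror_def[abs_def] by (intro borel_measurable_continuous_onI continuous_intros)

lemma lborel_distr_mirror: "distr lborel borel mirror = lborel"
proof -
  define c :: "real^2 \<Rightarrow> real" where "c j = (if j = axis 2 1 then - 1 else 1)" for j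
  have "(\<lambda>x. 0 + (\<Sum>j\<in>Basis. (c j * (x \<bullet> j)) *\<^sub>R j)) = mirror"
    by (auto simp: fun_eq_iff vec_eq_iff forall_2 Basis_real2 c_def axis_eq_axis inner_axis)
  then have "lborel = density (distr lborel borel mirror) (\<lambda>_. (\<Prod>j\<in>Basis. \<bar>c j\<bar>))"
    using lborel_affine_euclidean[of c 0] by (simp add: c_def)
  also have "(\<Prod>j\<in>Basis. \<bar>c j\<bar>) = 1" by (auto simp: c_def intro!: prod.neutral)
  finally show ?thesis by (simp add: density_1)
qed

lemma lborel_mirror:
  fixes f :: "real^2 \<Rightarrow> real"
  assumes [measurable]: "f \<in> borel_measurable borel"
  shows "(\<integral>x. f (mirror x) \<partial>lborel) = (\<integral>x. f x \<partial>lborel)"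
    and "integrable lborel (\<lambda>x. f (mirror x)) \<longleftrightarrow> integrable lborel f"
  using integral_distr[of mirror lborel borel f] integrable_distr_eq[of mirror lborel borel f]
  by (simp_all add: lborel_distr_mirror)

section \<open>Test functions in the tubes between the slits\<close>

text \<open>
  Down to height \<open>(1/2)^N\<close> the slits leave \<open>8^N\<close> tubes \<open>k < 8^N * foot x < k + 1\<close> free, and
  \<open>tubes N \<circ> foot\<close> is a bump function across each of them.
\<close>

definition tubes :: "nat \<Rightarrow> real \<Rightarrow> real" where
  "tubes N c = (\<Sum>k<8^N. bump (8^N * c - real k))"

text \<open>
  An even function, supported in \<open>(1/2)^N \<le> \<bar>t\<bar> \<le> 3/4\<close> if \<open>N \<ge> 2\<close>. For large \<open>N\<close> it is constant between an
  inner transition zone, which shrinks towards the axis as \<open>N\<close> grows, and an outer one, which is independent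
  of \<open>N\<close>.
\<close>

definition cutoff :: "nat \<Rightarrow> real \<Rightarrow> real" where
  "cutoff N t = step (2^N / 4 * t) + step (2^N / 4 * (- t)) - step t - step (- t)"

text \<open>
  The part above the axis of the derivative of \<open>cutoff N\<close> along the tubes that comes from the inner
  transition zone: a nonnegative density of fixed mass concentrating on the axis as \<open>N\<close> grows.
\<close>

definition layer :: "nat \<Rightarrow> real^2 \<Rightarrow> real" where
  "layer N x = 2^N / 4 * tubes N (foot x) * bump (2^N / 4 * x$2)"

lemma step_eq_0_nonpos: "t \<le> 0 \<Longrightarrow> step t = 0"
  by (rule step_eq_0) simp

lemma Ck_scaled:
  assumes "Ck k f" shows "Ck k (\<lambda>t::real. f (a * t - b))"
proof (rule Ck_compose[OF assms])
  show "Ck k (\<lambda>t. a * t - b)"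
    by (rule Ck_diff[OF Ck_mult[OF Ck_const Ck_ident] Ck_const])
qed

lemma Ck_tubes: "Ck k (tubes N)"
  unfolding tubes_def[abs_def] by (rule Ck_sum) (rule Ck_scaled[OF Ck_bump])

lemma Ck_cutoff: "Ck k (cutoff N)"
proof -
  have s: "Ck k (\<lambda>t. step (a * t))" for a
    using Ck_scaled[OF Ck_step, of k a 0] by simp
  have "Ck k (\<lambda>t. step (2^N / 4 * t) + step (- (2^N / 4) * t) - step (1 * t) - step (- 1 * t))"
    by (rule Ck_diff[OF Ck_diff[OF Ck_add[OF s s] s] s])
  then show ?thesis by (simp add: cutoff_def[abs_def])
qed

lemma tubes_nonzero_imp:
  assumes "tubes N c \<noteq> 0"
  obtains k where "k < 8^N" "1/4 \<le> 8^N * c - real k" "8^N * c - real k \<le> 3/4"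
proof -
  obtain k where "k < 8^N" "bump (8^N * c - real k) \<noteq> 0"
    using assms sum.not_neutral_contains_not_neutral unfolding tubes_def by blast
  then show thesis using that[of k] by (simp add: bump_nonzero_iff)
qed

lemma tubes_nonneg: "0 \<le> tubes N c"
  by (simp add: tubes_def sum_nonneg bump_nonneg)

lemma tubes_le_1: "tubes N c \<le> 1"
proof (cases "tubes N c = 0")
  case False
  then obtain k where k: "k < 8^N" "1/4 \<le> 8^N * c - real k" "8^N * c - real k \<le> 3/4"
    by (rule tubes_nonzero_imp)
  have "bump (8^N * c - real j) = 0" if "j \<noteq> k" for j
  proof -
    have "real j \<le> real k - 1 \<or> real k + 1 \<le> real j" using that by linarith
    then have "\<not> (1/4 < 8^N * c - real j \<and> 8^N * c - real j < 3/4)" using k by linarith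
    then show ?thesis using bump_nonzero_iff by blast
  qed
  then have "tubes N c = (\<Sum>j\<in>{k}. bump (8^N * c - real j))"
    unfolding tubes_def using k(1) by (intro sum.mono_neutral_right) auto
  then show ?thesis using bump_le_1 by simp
qed simp

lemma cutoff_eq_0:
  assumes "2 \<le> N" and t: "\<bar>t\<bar> \<le> (1/2)^N \<or> 3/4 \<le> \<bar>t\<bar>"
  shows "cutoff N t = 0"
proof -
  have N: "(4::real) \<le> 2^N" using power_increasing[of 2 N "2::real"] assms(1) by simp
  have pow: "(1/2::real)^N = 1 / 2^N" by (simp add: power_divide)
  have "cutoff N s = 0" if s: "0 \<le> s" "s \<le> (1/2)^N \<or> 3/4 \<le> s" for s
  proof -
    have neg: "step (2^N / 4 * (- s)) = 0" "step (- s) = 0"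
      using s(1) by (simp_all add: step_eq_0_nonpos)
    have "step (2^N / 4 * s) = step s"
    proof (cases "s \<le> (1/2)^N")
      case True
      then have "2^N / 4 * s \<le> 1/4" by (simp add: pow field_simps)
      moreover have "s \<le> 2^N / 4 * s" using N s(1) mult_right_mono[of 1 "2^N / 4" s] by simp
      ultimately show ?thesis by (simp add: step_eq_0)
    next
      case False
      then have "3/4 \<le> s" using s(2) by simp
      moreover have "s \<le> 2^N / 4 * s" using N s(1) mult_right_mono[of 1 "2^N / 4" s] by simp
      ultimately have "step (2^N / 4 * s) = step 1" "step s = step 1"
        by (meson order_trans step_ge_three_quarters)+
      then show ?thesis by simp
    qed
    then show ?thesis using neg by (simp add: cutoff_def)
  qed
  from this[of "\<bar>t\<bar>"] have "cutoff N \<bar>t\<bar> = 0" using t by simp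
  then show ?thesis by (auto simp: cutoff_def abs_if split: if_splits)
qed

lemma abs_cutoff_le_1: "\<bar>cutoff N t\<bar> \<le> 1"
proof -
  have "\<bar>cutoff N s\<bar> \<le> 1" if "0 \<le> s" for s
  proof -
    have "step (2^N / 4 * (- s)) = 0" "step (- s) = 0"
      using that by (simp_all add: step_eq_0_nonpos)
    then have "cutoff N s = step (2^N / 4 * s) - step s" by (simp add: cutoff_def)
    then show ?thesis
      using step_nonneg[of s] step_le_1[of s] step_nonneg[of "2^N / 4 * s"] step_le_1[of "2^N / 4 * s"]
      by linarith
  qed
  from this[of "\<bar>t\<bar>"] have "\<bar>cutoff N \<bar>t\<bar>\<bar> \<le> 1" by simp
  moreover have "cutoff N \<bar>t\<bar> = cutoff N t" by (auto simp: cutoff_def abs_if)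
  ultimately show ?thesis by simp
qed

lemma cutoff_has_derivative:
  "(cutoff N has_real_derivative
     2^N / 4 * (bump (2^N / 4 * t) - bump (2^N / 4 * (- t))) - (bump t - bump (- t))) (at t)"
proof -
  have s: "((\<lambda>t. step (a * t)) has_real_derivative bump (a * t) * a) (at t)" for a
    by (rule DERIV_chain'[OF _ step_has_derivative]) (auto intro!: derivative_eq_intros)
  have "((\<lambda>t. step (2^N / 4 * t) + step (- (2^N / 4) * t) - step (1 * t) - step (- 1 * t)) has_real_derivative
     bump (2^N / 4 * t) * (2^N / 4) + bump (- (2^N / 4) * t) * (- (2^N / 4)) - bump (1 * t) * 1 - bump (- 1 * t) * (- 1)) (at t)"
    by (rule DERIV_diff[OF DERIV_diff[OF DERIV_add[OF s s] s] s])
  then show ?thesis by (simp add: cutoff_def[abs_def] algebra_simps)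
qed

text \<open>
  A slit number \<open>n\<close> reaching the height of \<open>x\<close> has \<open>n \<le> N\<close>, so \<open>8^n * foot x\<close> being an integer would
  make \<open>8^N * foot x\<close> an integer, whereas the latter has distance at least \<open>1/4\<close> from the integers.
\<close>

lemma mem_comb_if_in_tube:
  assumes k: "k < 8^N" "1/4 \<le> 8^N * foot x - real k" "8^N * foot x - real k \<le> 3/4"
    and t: "(1/2)^N \<le> \<bar>x$2\<bar>" "\<bar>x$2\<bar> \<le> 3/4"
  shows "x \<in> comb_domain"
proof -
  have "0 < (8::real)^N * foot x" using k(2) by linarith
  then have "0 < foot x" by (simp add: zero_less_mult_iff)
  have "real k + 1 \<le> 8^N" using k(1) by (metis Suc_leI of_nat_Suc of_nat_le_iff of_nat_numeral of_nat_power add.commute)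
  then have "(8::real)^N * foot x < 8^N * 1" using k(3) by linarith
  then have "foot x < 1" by simp
  have "x \<notin> slit n" if "0 < x$2" for n
  proof
    assume "x \<in> slit n"
    then have n: "x$2 \<le> (1/2)^n" "8^n * foot x \<in> \<int>" by (auto simp: slit_def)
    have "(1/2::real)^N \<le> (1/2)^n" using t(1) n(1) that by linarith
    then have "n \<le> N" by simp
    then have "8^N * foot x = 8^(N - n) * (8^n * foot x)" by (simp add: power_add[symmetric] mult.assoc[symmetric])
    also have "\<dots> \<in> \<int>" by (rule Ints_mult[OF _ n(2)]) auto
    finally obtain z where "8^N * foot x = of_int z" by (auto elim: Ints_cases)
    then have "1/4 \<le> real_of_int (z - int k)" "real_of_int (z - int k) \<le> 3/4" using k(2,3) by simp_all
    then have "0 < real_of_int (z - int k)" "real_of_int (z - int k) < 1" by linarith+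
    then have "0 < z - int k" "z - int k < 1" by (simp_all only: of_int_0_less_iff of_int_less_1_iff)
    then show False by linarith
  qed
  moreover have "0 < \<bar>x$2\<bar>" by (rule less_le_trans[OF _ t(1)]) simp
  ultimately show ?thesis
    using t(2) \<open>0 < foot x\<close> \<open>foot x < 1\<close> by (auto simp: comb_domain_def)
qed

lemma test_function_tubes:
  assumes N: "2 \<le> N" and g: "\<And>k. Ck k g"
  shows "test_function comb_domain (\<lambda>x. g x * (tubes N (foot x) * cutoff N (x$2)))" (is "test_function _ ?\<phi>")
  unfolding test_function_def
proof (intro conjI allI)
  have nth: "Ck k (\<lambda>x::real^2. x$i)" for k i
    by (rule Ck_linear[OF bounded_linear_vec_nth])
  have foot: "Ck k foot" for k
    unfolding foot_def[abs_def] power2_eq_square by (rule Ck_diff[OF nth Ck_mult[OF nth nth]])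
  show "Ck k ?\<phi>" for k
    by (rule Ck_mult[OF g Ck_mult[OF Ck_compose[OF Ck_tubes foot] Ck_compose[OF Ck_cutoff nth]]])
  define C where "C = (\<Union>k<8^N. {x. 1/4 \<le> 8^N * foot x - real k} \<inter> {x. 8^N * foot x - real k \<le> 3/4})"
  define K where "K = C \<inter> {x. (1/2)^N \<le> \<bar>x$2\<bar>} \<inter> {x. \<bar>x$2\<bar> \<le> 3/4}"
  have "closed K"
    unfolding K_def C_def
    by (intro closed_Int closed_UN ballI closed_Collect_le continuous_intros) simp
  have "K \<subseteq> comb_domain"
    unfolding K_def C_def using mem_comb_if_in_tube by auto
  have sub: "closure {x. ?\<phi> x \<noteq> 0} \<subseteq> K"
  proof (rule closure_minimal[OF _ \<open>closed K\<close>], rule subsetI)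
    fix x assume "x \<in> {x. ?\<phi> x \<noteq> 0}"
    then have nz: "tubes N (foot x) \<noteq> 0" "cutoff N (x$2) \<noteq> 0" by auto
    have "(1/2)^N \<le> \<bar>x$2\<bar>" "\<bar>x$2\<bar> \<le> 3/4"
      using cutoff_eq_0[OF N, of "x$2"] nz(2) by linarith+
    moreover have "x \<in> C" using nz(1) by (rule tubes_nonzero_imp) (auto simp: C_def)
    ultimately show "x \<in> K" by (simp add: K_def)
  qed
  then show "closure {x. ?\<phi> x \<noteq> 0} \<subseteq> comb_domain" using \<open>K \<subseteq> comb_domain\<close> by simp
  show "compact (closure {x. ?\<phi> x \<noteq> 0})"
    unfolding compact_eq_bounded_closed
    using bounded_subset[OF bounded_comb] \<open>K \<subseteq> comb_domain\<close> sub by auto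
qed

lemma layer_minus_mirror:
  "layer N x - layer N (mirror x) =
     2^N / 4 * tubes N (foot x) * (bump (2^N / 4 * x$2) - bump (2^N / 4 * (- x$2)))"
  by (simp add: layer_def algebra_simps)

lemma layer_nonneg: "0 \<le> layer N x"
  by (simp add: layer_def tubes_nonneg bump_nonneg)

lemma continuous_on_tubes: "continuous_on S f \<Longrightarrow> continuous_on S (\<lambda>x. tubes N (f x))"
  by (rule continuous_on_compose2[OF Ck_continuous_on[OF Ck_tubes, of UNIV]]) auto

lemma continuous_on_bump_compose: "continuous_on S f \<Longrightarrow> continuous_on S (\<lambda>x. bump (f x))"
  by (rule continuous_on_compose2[OF continuous_on_bump[of UNIV]]) auto

lemma continuous_on_cutoff: "continuous_on S f \<Longrightarrow> continuous_on S (\<lambda>x. cutoff N (f x))"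
  by (rule continuous_on_compose2[OF Ck_continuous_on[OF Ck_cutoff, of UNIV]]) auto

lemmas continuous_on_profiles = continuous_on_tubes continuous_on_bump_compose continuous_on_cutoff

lemma measurable_layer [measurable]: "layer N \<in> borel_measurable borel"
  unfolding layer_def[abs_def]
  by (intro borel_measurable_continuous_onI continuous_intros continuous_on_profiles)

lemma layer_nonzero_imp:
  assumes "2 \<le> N" "layer N x \<noteq> 0"
  shows "x \<in> comb_domain" "mirror x \<in> comb_domain" "x \<in> upper_half" "mirror x \<notin> upper_half" "dist x (mirror x) \<le> 6 / 2^N"
proof -
  have nz: "tubes N (foot x) \<noteq> 0" "bump (2^N / 4 * x$2) \<noteq> 0"
    using assms(2) by (auto simp: layer_def)
  have N: "(4::real) \<le> 2^N" using power_increasing[of 2 N "2::real"] assms(1) by simp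
  have "1 < 2^N * x$2" "2^N * x$2 < 3" using nz(2) by (simp_all add: bump_nonzero_iff)
  then have t: "1 / 2^N < x$2" "x$2 < 3 / 2^N" by (simp_all add: field_simps)
  then have pos: "0 < x$2" by (meson divide_pos_pos less_trans zero_less_one zero_less_power zero_less_numeral)
  have "3 / 2^N \<le> (3/4::real)" using N by (simp add: field_simps)
  then have "(1/2)^N \<le> \<bar>x$2\<bar>" "\<bar>x$2\<bar> \<le> 3/4" using t pos by (simp_all add: power_divide)
  moreover obtain k where "k < 8^N" "1/4 \<le> 8^N * foot x - real k" "8^N * foot x - real k \<le> 3/4"
    using nz(1) by (rule tubes_nonzero_imp)
  ultimately show "x \<in> comb_domain" "mirror x \<in> comb_domain"
    by (auto intro: mem_comb_if_in_tube)
  show "x \<in> upper_half" "mirror x \<notin> upper_half" using pos by (auto simp: upper_half_def)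
  have "dist x (mirror x) = 2 * x$2" using pos by (simp add: dist_norm mirror_def)
  then show "dist x (mirror x) \<le> 6 / 2^N" using t by simp
qed

lemma nn_integral_bump_affine:
  assumes "0 < a"
  shows "(\<integral>\<^sup>+t. ennreal (bump (a * t - b)) \<partial>lborel) = ennreal (step 1 / a)"
proof -
  have [measurable]: "bump \<in> borel_measurable borel"
    by (rule borel_measurable_continuous_onI[OF continuous_on_bump])
  have "(\<integral>\<^sup>+t. ennreal (bump t) \<partial>lborel) = (\<integral>\<^sup>+t. ennreal (bump t) * indicator {0..1} t \<partial>lborel)"
  proof (rule nn_integral_cong)
    fix t show "ennreal (bump t) = ennreal (bump t) * indicator {0..1} t"
      using bump_nonzero_iff[of t] by (cases "bump t = 0") auto
  qed
  also have "\<dots> = ennreal (step 1 - step 0)"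
    by (rule nn_integral_FTC_Icc) (auto simp: bump_nonneg step_has_derivative)
  finally have "ennreal (step 1) = (\<integral>\<^sup>+t. ennreal (bump t) \<partial>lborel)" by (simp add: step_eq_0)
  also have "\<dots> = ennreal a * (\<integral>\<^sup>+t. ennreal (bump (a * t - b)) \<partial>lborel)"
    using nn_integral_real_affine[of "\<lambda>t. ennreal (bump t)" a "- b"] assms by simp
  finally have *: "ennreal (step 1) = ennreal a * (\<integral>\<^sup>+t. ennreal (bump (a * t - b)) \<partial>lborel)" .
  have "ennreal (step 1 / a) = ennreal (1 / a) * ennreal (step 1)"
    using assms step_nonneg by (simp flip: ennreal_mult)
  also have "\<dots> = (ennreal (1 / a) * ennreal a) * (\<integral>\<^sup>+t. ennreal (bump (a * t - b)) \<partial>lborel)"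
    by (simp add: * mult.assoc)
  also have "ennreal (1 / a) * ennreal a = 1" using assms by (simp flip: ennreal_mult)
  finally show ?thesis by simp
qed

text \<open>
  Each of the \<open>8^N\<close> tubes contributes \<open>step 1 / 8^N\<close>, so the total does not depend on \<open>N\<close>.
\<close>

lemma nn_integral_tubes: "(\<integral>\<^sup>+s. ennreal (tubes N (s - b)) \<partial>lborel) = ennreal (step 1)"
proof -
  have [measurable]: "bump \<in> borel_measurable borel"
    by (rule borel_measurable_continuous_onI[OF continuous_on_bump])
  have "(\<integral>\<^sup>+s. ennreal (tubes N (s - b)) \<partial>lborel) =
      (\<integral>\<^sup>+s. (\<Sum>k<8^N. ennreal (bump (8^N * s - (8^N * b + real k)))) \<partial>lborel)"
    by (simp add: tubes_def sum_ennreal bump_nonneg algebra_simps)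
  also have "\<dots> = (\<Sum>k<8^N. (\<integral>\<^sup>+s. ennreal (bump (8^N * s - (8^N * b + real k))) \<partial>lborel))"
    by (rule nn_integral_sum) measurable
  also have "\<dots> = (\<Sum>k<(8::nat)^N. ennreal (step 1 / 8^N))"
    by (simp add: nn_integral_bump_affine)
  also have "\<dots> = ennreal (\<Sum>k<(8::nat)^N. step 1 / 8^N)"
    by (rule sum_ennreal) (simp add: step_nonneg)
  also have "(\<Sum>k<(8::nat)^N. step 1 / 8^N) = step 1" by simp
  finally show ?thesis .
qed

text \<open>
  The shear \<open>x \<mapsto> (foot x, x$2)\<close> preserves areas; in the iterated integral it is a translation of the
  inner variable.
\<close>

lemma layer_integral:
  shows integrable_layer: "integrable lborel (layer N)"
    and integral_layer: "(\<integral>x. layer N x \<partial>lborel) = (step 1)\<^sup>2"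
proof -
  have [measurable]: "bump \<in> borel_measurable borel"
    by (rule borel_measurable_continuous_onI[OF continuous_on_bump])
  have [measurable]: "tubes N \<in> borel_measurable borel"
    by (rule borel_measurable_continuous_onI[OF Ck_continuous_on[OF Ck_tubes]])
  let ?a = "2^N / 4 :: real"
  have "(\<integral>\<^sup>+x. ennreal (layer N x) \<partial>lborel) =
      (\<integral>\<^sup>+t. \<integral>\<^sup>+s. ennreal (?a * bump (?a * t)) * ennreal (tubes N (s - t\<^sup>2)) \<partial>lborel \<partial>lborel)"
    by (subst nn_integral_real2)
       (auto intro!: nn_integral_cong simp: layer_def foot_def bump_nonneg tubes_nonneg mult_ac simp flip: ennreal_mult)
  also have "\<dots> = (\<integral>\<^sup>+t. ennreal (?a * bump (?a * t)) * ennreal (step 1) \<partial>lborel)"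
    by (subst nn_integral_cmult) (auto simp: nn_integral_tubes)
  also have "\<dots> = (\<integral>\<^sup>+t. ennreal (?a * step 1) * ennreal (bump (?a * t - 0)) \<partial>lborel)"
    by (auto intro!: nn_integral_cong simp: bump_nonneg step_nonneg mult_ac simp flip: ennreal_mult)
  also have "\<dots> = ennreal (?a * step 1) * (\<integral>\<^sup>+t. ennreal (bump (?a * t - 0)) \<partial>lborel)"
    by (rule nn_integral_cmult) measurable
  also have "\<dots> = ennreal ((step 1)\<^sup>2)"
    by (subst nn_integral_bump_affine) (auto simp: step_nonneg power2_eq_square simp flip: ennreal_mult)
  finally have nn: "(\<integral>\<^sup>+x. ennreal (layer N x) \<partial>lborel) = ennreal ((step 1)\<^sup>2)" .
  show "integrable lborel (layer N)"
    by (rule integrableI_nonneg) (auto simp: nn layer_nonneg)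
  show "(\<integral>x. layer N x \<partial>lborel) = (step 1)\<^sup>2"
    by (subst integral_eq_nn_integral) (auto simp: nn layer_nonneg)
qed

section \<open>No approximation by functions continuous up to the boundary\<close>

lemma foot_has_derivative: "(foot has_derivative (\<lambda>h. h$1 - 2 * x$2 * h$2)) (at x)"
  unfolding foot_def[abs_def]
  by (auto intro!: derivative_eq_intros bounded_linear_imp_has_derivative[OF bounded_linear_vec_nth])

text \<open>
  The field \<open>(2 t, 1)\<close> at height \<open>t\<close> is tangent to the parabolas \<open>foot x = c\<close>, so along it only the
  factor \<open>cutoff N\<close> of the test function is differentiated.
\<close>

lemma tube_test_function_derivatives:
  fixes N :: nat and x :: "real^2"
  defines "\<phi> \<equiv> \<lambda>x. tubes N (foot x) * cutoff N (x$2)"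
  shows "frechet_derivative \<phi> (at x) (axis 2 1) + frechet_derivative (\<lambda>x. 2 * x$2 * \<phi> x) (at x) (axis 1 1)
    = layer N x - layer N (mirror x) - tubes N (foot x) * (bump (x$2) - bump (- x$2))"
proof -
  let ?T' = "frechet_derivative (tubes N) (at (foot x)) 1"
  let ?C' = "2^N / 4 * (bump (2^N / 4 * x$2) - bump (2^N / 4 * (- x$2))) - (bump (x$2) - bump (- x$2))"
  have nth: "((\<lambda>x::real^2. x$2) has_derivative (\<lambda>h. h$2)) (at x)"
    by (rule bounded_linear_imp_has_derivative[OF bounded_linear_vec_nth])
  have T: "((\<lambda>x. tubes N (foot x)) has_derivative (\<lambda>h. ?T' * (h$1 - 2 * x$2 * h$2))) (at x)"
    by (rule has_derivative_compose[OF foot_has_derivative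
          Ck_Suc_imp_DERIV[OF Ck_tubes, unfolded has_field_derivative_def]])
  have C: "((\<lambda>x. cutoff N (x$2)) has_derivative (\<lambda>h. ?C' * h$2)) (at x)"
    by (rule has_derivative_compose[OF nth cutoff_has_derivative[unfolded has_field_derivative_def]])
  note \<phi> = has_derivative_mult[OF T C, folded \<phi>_def]
  note \<psi> = has_derivative_mult[OF has_derivative_mult[OF has_derivative_const nth, of 2] \<phi>]
  have D\<phi>: "frechet_derivative \<phi> (at x) = (\<lambda>h. tubes N (foot x) * (?C' * h$2) + ?T' * (h$1 - 2 * x$2 * h$2) * cutoff N (x$2))"
    by (rule frechet_derivative_at[OF \<phi>, symmetric])
  have D\<psi>: "frechet_derivative (\<lambda>x. 2 * x$2 * \<phi> x) (at x) = (\<lambda>h. 2 * x$2 * (tubes N (foot x) * (?C' * h$2)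
      + ?T' * (h$1 - 2 * x$2 * h$2) * cutoff N (x$2)) + (2 * h$2 + 0 * x$2) * \<phi> x)"
    by (rule frechet_derivative_at[OF \<psi>, symmetric])
  show ?thesis
    unfolding D\<phi> D\<psi> layer_minus_mirror by (simp add: algebra_simps)
qed

lemma abs_integral_mult_le:
  fixes f g :: "'a \<Rightarrow> real"
  assumes "integrable M f" "integrable M (\<lambda>x. f x * g x)" "\<And>x. x \<in> space M \<Longrightarrow> \<bar>g x\<bar> \<le> B"
  shows "\<bar>\<integral>x. f x * g x \<partial>M\<bar> \<le> B * (\<integral>x. \<bar>f x\<bar> \<partial>M)"
proof -
  have "\<bar>\<integral>x. f x * g x \<partial>M\<bar> \<le> (\<integral>x. \<bar>f x * g x\<bar> \<partial>M)"
    by (rule integral_abs_bound)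
  also have "\<dots> \<le> (\<integral>x. B * \<bar>f x\<bar> \<partial>M)"
  proof (rule integral_mono)
    show "\<bar>f x * g x\<bar> \<le> B * \<bar>f x\<bar>" if "x \<in> space M" for x
      using mult_right_mono[OF assms(3)[OF that], of "\<bar>f x\<bar>"] by (simp add: abs_mult mult.commute)
  qed (use assms in auto)
  finally show ?thesis by simp
qed

text \<open>
  Test \<open>d2\<close> with \<open>\<phi> = tubes N (foot x) * cutoff N (x$2)\<close> and \<open>d1\<close> with \<open>2 * x$2 * \<phi>\<close>. These functions are
  bounded independently of \<open>N\<close>, as is the contribution \<open>e\<close> of the outer transition zones, while the inner
  ones give the left-hand side. The factor \<open>2\<close> bounds \<open>2 * \<bar>x$2\<bar>\<close>.
\<close>

lemma jump_bounded_by_H1: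
  fixes w d1 d2 :: "real^2 \<Rightarrow> real"
  assumes N: "2 \<le> N"
    and sq: "square_integrable (lebesgue_on comb_domain) w" "square_integrable (lebesgue_on comb_domain) d1"
      "square_integrable (lebesgue_on comb_domain) d2"
    and d1: "is_weak_deriv comb_domain (axis 1 1) w d1" and d2: "is_weak_deriv comb_domain (axis 2 1) w d2"
  shows "\<bar>\<integral>x. w x * (layer N x - layer N (mirror x)) \<partial>lebesgue_on comb_domain\<bar>
    \<le> (\<integral>x. \<bar>w x\<bar> \<partial>lebesgue_on comb_domain) + 2 * (\<integral>x. \<bar>d1 x\<bar> \<partial>lebesgue_on comb_domain) + (\<integral>x. \<bar>d2 x\<bar> \<partial>lebesgue_on comb_domain)"
proof -
  let ?M = "lebesgue_on comb_domain"
  interpret finite_measure ?M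
    using open_comb bounded_comb by (rule finite_measure_lebesgue_on_bounded_open)
  define \<phi> where "\<phi> x = tubes N (foot x) * cutoff N (x$2)" for x
  define \<psi> where "\<psi> x = 2 * x$2 * \<phi> x" for x
  define e where "e x = tubes N (foot x) * (bump (x$2) - bump (- x$2))" for x
  have test\<phi>: "test_function comb_domain \<phi>"
    using test_function_tubes[OF N Ck_const[of _ 1]] by (simp add: \<phi>_def[abs_def])
  have "Ck k (\<lambda>x::real^2. 2 * x$2)" for k
    by (rule Ck_mult[OF Ck_const Ck_linear[OF bounded_linear_vec_nth]])
  then have test\<psi>: "test_function comb_domain \<psi>"
    unfolding \<psi>_def[abs_def] \<phi>_def by (rule test_function_tubes[OF N])
  have int: "integrable ?M (\<lambda>x. f x * g x)"
    if "square_integrable ?M f" "continuous_on UNIV g" "\<And>x. x \<in> space ?M \<Longrightarrow> \<bar>g x\<bar> \<le> B" for f g B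
    using that by (intro integrable_square_integrable_mult[where B = B])
      (auto intro!: measurable_restrict_space1 measurable_completion borel_measurable_continuous_onI)
  have int1: "integrable ?M f" if "square_integrable ?M f" for f
    using int[OF that, of "\<lambda>_. 1" 1] by simp
  have b\<phi>: "\<bar>\<phi> x\<bar> \<le> 1" for x
    using tubes_nonneg[of N "foot x"] tubes_le_1[of N "foot x"] abs_cutoff_le_1[of N "x$2"]
    by (simp add: \<phi>_def abs_mult mult_le_one)
  have b\<psi>: "\<bar>\<psi> x\<bar> \<le> 2" if "x \<in> space ?M" for x
  proof -
    have "\<bar>x$2\<bar> < 1" using that by (simp add: comb_domain_def)
    then have "\<bar>x$2\<bar> * \<bar>\<phi> x\<bar> \<le> 1" using b\<phi>[of x] by (intro mult_le_one) auto
    then show ?thesis by (simp add: \<psi>_def abs_mult)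
  qed
  have be: "\<bar>e x\<bar> \<le> 1" for x
  proof -
    have "\<bar>bump (x$2) - bump (- x$2)\<bar> \<le> 1"
      using bump_nonneg[of "x$2"] bump_le_1[of "x$2"] bump_nonneg[of "- x$2"] bump_le_1[of "- x$2"] by linarith
    then show ?thesis
      using tubes_nonneg[of N "foot x"] tubes_le_1[of N "foot x"] by (simp add: e_def abs_mult mult_le_one)
  qed
  have ce: "continuous_on UNIV e"
    unfolding e_def[abs_def] by (intro continuous_intros continuous_on_profiles)
  have c\<phi>: "continuous_on UNIV \<phi>" "continuous_on UNIV \<psi>"
    using test\<phi> test\<psi> test_function_Ck Ck_continuous_on by blast+
  let ?D\<phi> = "\<lambda>x. frechet_derivative \<phi> (at x) (axis 2 1)" and ?D\<psi> = "\<lambda>x. frechet_derivative \<psi> (at x) (axis 1 1)"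
  have intD: "integrable ?M (\<lambda>x. w x * frechet_derivative \<zeta> (at x) \<theta>)" if \<zeta>: "test_function comb_domain \<zeta>" for \<zeta> \<theta>
  proof -
    obtain K where K: "compact K" "K \<subseteq> comb_domain" "\<And>x. x \<notin> K \<Longrightarrow> \<zeta> x = 0"
      "\<And>x. x \<notin> K \<Longrightarrow> frechet_derivative \<zeta> (at x) \<theta> = 0"
      by (rule test_function_support[OF \<zeta>, of \<theta>]) (rule that)
    have c: "continuous_on UNIV (\<lambda>x. frechet_derivative \<zeta> (at x) \<theta>)"
      by (rule continuous_on_directional_derivative[OF test_function_Ck[OF \<zeta>]])
    obtain B where "\<And>x. \<bar>frechet_derivative \<zeta> (at x) \<theta>\<bar> \<le> B"
      using continuous_compact_support_bounded[OF c K(1,4)] by blast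
    then show ?thesis using int[OF sq(1) c] by blast
  qed
  have eq: "layer N x - layer N (mirror x) = ?D\<phi> x + ?D\<psi> x + e x" for x
    using tube_test_function_derivatives[of N x] by (simp add: \<phi>_def[abs_def] \<psi>_def[abs_def] e_def)
  have "(\<integral>x. w x * (layer N x - layer N (mirror x)) \<partial>?M)
      = (\<integral>x. w x * ?D\<phi> x + w x * ?D\<psi> x + w x * e x \<partial>?M)"
    by (simp add: eq distrib_left)
  also have "\<dots> = (\<integral>x. w x * ?D\<phi> x \<partial>?M) + (\<integral>x. w x * ?D\<psi> x \<partial>?M) + (\<integral>x. w x * e x \<partial>?M)"
    using intD[OF test\<phi>] intD[OF test\<psi>] int[OF sq(1) ce be] by simp
  also have "\<dots> = - (\<integral>x. d2 x * \<phi> x \<partial>?M) - (\<integral>x. d1 x * \<psi> x \<partial>?M) + (\<integral>x. w x * e x \<partial>?M)"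
    using d1 d2 test\<phi> test\<psi> by (simp add: is_weak_deriv_def)
  finally have "\<bar>\<integral>x. w x * (layer N x - layer N (mirror x)) \<partial>?M\<bar>
      \<le> \<bar>\<integral>x. d2 x * \<phi> x \<partial>?M\<bar> + \<bar>\<integral>x. d1 x * \<psi> x \<partial>?M\<bar> + \<bar>\<integral>x. w x * e x \<partial>?M\<bar>"
    by linarith
  moreover have "\<bar>\<integral>x. d2 x * \<phi> x \<partial>?M\<bar> \<le> 1 * (\<integral>x. \<bar>d2 x\<bar> \<partial>?M)"
    using int1[OF sq(3)] int[OF sq(3) c\<phi>(1) b\<phi>] b\<phi> by (rule abs_integral_mult_le)
  moreover have "\<bar>\<integral>x. d1 x * \<psi> x \<partial>?M\<bar> \<le> 2 * (\<integral>x. \<bar>d1 x\<bar> \<partial>?M)"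
    using int1[OF sq(2)] int[OF sq(2) c\<phi>(2) b\<psi>] b\<psi> by (rule abs_integral_mult_le)
  moreover have "\<bar>\<integral>x. w x * e x \<partial>?M\<bar> \<le> 1 * (\<integral>x. \<bar>w x\<bar> \<partial>?M)"
    using int1[OF sq(1)] int[OF sq(1) ce be] be by (rule abs_integral_mult_le)
  ultimately show ?thesis by linarith
qed

text \<open>
  Integrate \<open>\<bar>f\<bar> \<le> \<epsilon> / 2 + f\<^sup>2 / (2 * \<epsilon>)\<close>.
\<close>

lemma (in finite_measure) integral_abs_le_of_integral_square:
  fixes f :: "'a \<Rightarrow> real"
  assumes f: "square_integrable M f" and "0 < \<epsilon>" and le: "(\<integral>x. (f x)\<^sup>2 \<partial>M) \<le> \<epsilon>\<^sup>2"
  shows "(\<integral>x. \<bar>f x\<bar> \<partial>M) \<le> \<epsilon> * (measure M (space M) + 1) / 2"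
proof -
  have int: "integrable M (\<lambda>x. (f x)\<^sup>2)" using f by (simp add: square_integrable_def)
  have "integrable M (\<lambda>x. \<bar>f x\<bar>)"
    using integrable_square_integrable_mult[OF f, of "\<lambda>_. 1" 1] by simp
  then have "(\<integral>x. \<bar>f x\<bar> \<partial>M) \<le> (\<integral>x. \<epsilon> / 2 + (f x)\<^sup>2 / (2 * \<epsilon>) \<partial>M)"
  proof (rule integral_mono)
    show "integrable M (\<lambda>x. \<epsilon> / 2 + (f x)\<^sup>2 / (2 * \<epsilon>))" using int by simp
    fix x
    have "2 * \<epsilon> * \<bar>f x\<bar> \<le> \<epsilon>\<^sup>2 + (f x)\<^sup>2"
      using zero_le_power2[of "\<epsilon> - \<bar>f x\<bar>"] by (simp add: power2_eq_square algebra_simps)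
    then show "\<bar>f x\<bar> \<le> \<epsilon> / 2 + (f x)\<^sup>2 / (2 * \<epsilon>)"
      using \<open>0 < \<epsilon>\<close> by (simp add: field_simps power2_eq_square)
  qed
  also have "\<dots> = \<epsilon> / 2 * measure M (space M) + (\<integral>x. (f x)\<^sup>2 \<partial>M) / (2 * \<epsilon>)"
    using int by simp
  also have "(\<integral>x. (f x)\<^sup>2 \<partial>M) / (2 * \<epsilon>) \<le> \<epsilon>\<^sup>2 / (2 * \<epsilon>)"
    using le \<open>0 < \<epsilon>\<close> by (simp add: divide_right_mono)
  finally show ?thesis using \<open>0 < \<epsilon>\<close> by (simp add: power2_eq_square field_simps)
qed

text \<open>
  By reflection in the axis the integral equals that of \<open>(w x - w (mirror x)) * layer N x\<close>, where
  \<open>w = indicator upper_half - v\<close>. On the support of \<open>layer N\<close> the points \<open>x\<close> and \<open>mirror x\<close> lie on opposite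
  sides and close to each other, so the indicator jumps by \<open>1\<close> and \<open>v\<close> by less than \<open>1/2\<close> once \<open>N\<close> is large.
\<close>

lemma jump_integral_lower_bound:
  fixes v :: "real^2 \<Rightarrow> real"
  assumes cont: "continuous_on (closure comb_domain) v"
  obtains N where "2 \<le> N"
    "(step 1)\<^sup>2 / 2 \<le> (\<integral>x. (indicator upper_half x - v x) * (layer N x - layer N (mirror x)) \<partial>lebesgue_on comb_domain)"
proof -
  have "compact (closure comb_domain)" using bounded_comb by (simp add: compact_closure)
  with cont obtain d where d: "0 < d"
    "\<And>x y. x \<in> closure comb_domain \<Longrightarrow> y \<in> closure comb_domain \<Longrightarrow> dist x y < d \<Longrightarrow> dist (v x) (v y) < 1/2"
    using compact_uniformly_continuous[OF cont] unfolding uniformly_continuous_on_def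
    by (metis half_gt_zero zero_less_one)
  obtain n where n: "(1/2)^n < d / 6" using real_arch_pow_inv[of "d / 6" "1/2"] d(1) by auto
  define N where "N = n + 2"
  have N: "2 \<le> N" by (simp add: N_def)
  have "(1/2::real)^N \<le> (1/2)^n" by (rule power_decreasing) (auto simp: N_def)
  then have small: "6 / 2^N < d" using n by (simp add: power_divide)
  obtain B where B: "\<And>x. x \<in> closure comb_domain \<Longrightarrow> \<bar>v x\<bar> \<le> B"
    using compact_imp_bounded[OF compact_continuous_image[OF cont \<open>compact (closure comb_domain)\<close>]]
    unfolding bounded_iff by auto
  \<comment> \<open>cut off outside the domain, because \<open>v\<close> is controlled only there\<close>
  define w where "w x = indicator comb_domain x * (indicator upper_half x - v x)" for x
  have sub: "x \<in> closure comb_domain" if "x \<in> comb_domain" for x using that closure_subset by blast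
  have [measurable]: "w \<in> borel_measurable borel"
  proof -
    have "(\<lambda>x. indicator comb_domain x *\<^sub>R v x) \<in> borel_measurable borel"
      using open_comb continuous_on_subset[OF cont closure_subset]
      by (intro borel_measurable_continuous_on_indicator) auto
    moreover have "upper_half \<in> sets borel"
      unfolding upper_half_def by (intro borel_open open_Collect_less continuous_intros)
    moreover have "comb_domain \<in> sets borel" using open_comb by simp
    ultimately show ?thesis unfolding w_def[abs_def] right_diff_distrib by simp
  qed
  have bound: "\<bar>w x\<bar> \<le> 1 + \<bar>B\<bar>" for x
    using B[OF sub, of x] by (auto simp: w_def indicator_def)
  have int: "integrable lborel (\<lambda>x. g x * layer N x)"
    if [measurable]: "g \<in> borel_measurable borel" and g: "\<And>x. \<bar>g x\<bar> \<le> 1 + \<bar>B\<bar>" for g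
  proof (rule Bochner_Integration.integrable_bound)
    show "integrable lborel (\<lambda>x. (1 + \<bar>B\<bar>) * layer N x)" using integrable_layer by simp
    show "AE x in lborel. norm (g x * layer N x) \<le> norm ((1 + \<bar>B\<bar>) * layer N x)"
      using g by (auto simp: abs_mult intro!: mult_right_mono order_trans[OF g])
  qed measurable
  have int1: "integrable lborel (\<lambda>x. w x * layer N x)" and int2: "integrable lborel (\<lambda>x. w (mirror x) * layer N x)"
    using bound by (auto intro!: int)
  have int3: "integrable lborel (\<lambda>x. w x * layer N (mirror x))"
    and refl: "(\<integral>x. w x * layer N (mirror x) \<partial>lborel) = (\<integral>x. w (mirror x) * layer N x \<partial>lborel)"
    using lborel_mirror[of "\<lambda>x. w (mirror x) * layer N x"] int2 by simp_all
  have "(step 1)\<^sup>2 / 2 = (\<integral>x. layer N x / 2 \<partial>lborel)" by (simp add: integral_layer)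
  also have "\<dots> \<le> (\<integral>x. w x * layer N x - w (mirror x) * layer N x \<partial>lborel)"
  proof (rule integral_mono)
    show "layer N x / 2 \<le> w x * layer N x - w (mirror x) * layer N x" for x
    proof (cases "layer N x = 0")
      case False
      note supp = layer_nonzero_imp[OF N False]
      have "dist (v x) (v (mirror x)) < 1/2"
        using supp small by (intro d(2) sub) auto
      then have "1/2 \<le> w x - w (mirror x)"
        using supp by (simp add: w_def dist_real_def abs_if split: if_splits)
      then have "1/2 * layer N x \<le> (w x - w (mirror x)) * layer N x"
        by (rule mult_right_mono) (rule layer_nonneg)
      then show ?thesis by (simp add: left_diff_distrib)
    qed simp
  qed (use integrable_layer int1 int2 in auto)
  also have "\<dots> = (\<integral>x. w x * (layer N x - layer N (mirror x)) \<partial>lborel)"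
    using int1 int2 int3 refl by (simp add: right_diff_distrib)
  also have "\<dots> = (\<integral>x. w x * (layer N x - layer N (mirror x)) \<partial>lebesgue_on comb_domain)"
      proof (rule integral_lebesgue_on_eq_lborel[OF open_comb, symmetric])
    show "(\<lambda>x. w x * (layer N x - layer N (mirror x))) \<in> borel_measurable borel" by measurable
  qed (simp add: w_def)
  also have "\<dots> = (\<integral>x. (indicator upper_half x - v x) * (layer N x - layer N (mirror x)) \<partial>lebesgue_on comb_domain)"
    by (rule Bochner_Integration.integral_cong) (auto simp: w_def)
  finally show thesis using N that by blast
qed

lemma indicator_upper_half_notin_H1_tilde: "indicator upper_half \<notin> H1_tilde comb_domain"
proof
  let ?M = "lebesgue_on comb_domain" and ?u = "indicator upper_half :: real^2 \<Rightarrow> real"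
  interpret finite_measure ?M
    using open_comb bounded_comb by (rule finite_measure_lebesgue_on_bounded_open)
  define m where "m = measure ?M (space ?M) + 1"
  \<comment> \<open>the bound \<open>2 * \<epsilon> * m\<close> on the jump integral is then half of its lower bound \<open>(step 1)\<^sup>2 / 2\<close>\<close>
  define \<epsilon> where "\<epsilon> = (step 1)\<^sup>2 / (8 * m)"
  have m: "0 < m" by (simp add: m_def add_nonneg_pos)
  then have \<epsilon>: "0 < \<epsilon>" using step_1_pos by (simp add: \<epsilon>_def)
  assume "?u \<in> H1_tilde comb_domain"
  then obtain v where v: "v \<in> H1 comb_domain" "continuous_on (closure comb_domain) v"
    and near: "H1_norm comb_domain (\<lambda>x. ?u x - v x) < \<epsilon>"
    using \<epsilon> unfolding H1_tilde_def by blast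
  define w where "w x = ?u x - v x" for x
  define d where "d i = weak_deriv comb_domain i w" for i
  have W: "w \<in> W i comb_domain" if "i \<in> Basis" for i
    unfolding w_def[abs_def]
    using v(1) that indicator_mem_W[OF bounded_comb open_comb_above open_comb_below]
    by (intro W_diff open_comb bounded_comb) (auto simp: H1_def)
  then have sqw: "square_integrable ?M w" using SOME_Basis by (auto simp: W_def)
  have d: "square_integrable ?M (d i) \<and> is_weak_deriv comb_domain i w (d i)" if "i \<in> Basis" for i
  proof -
    have "\<exists>v. square_integrable ?M v \<and> is_weak_deriv comb_domain i w v"
      using W[OF that] by (auto simp: W_def)
    then show ?thesis unfolding d_def weak_deriv_def by (rule someI_ex)
  qed
  have Basis: "axis 1 1 \<in> (Basis :: (real^2) set)" "axis 2 1 \<in> (Basis :: (real^2) set)"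
    unfolding Basis_real2 by blast+
  define S where "S = (\<integral>x. (w x)\<^sup>2 \<partial>?M) + (\<Sum>i\<in>Basis. \<integral>x. (d i x)\<^sup>2 \<partial>?M)"
  have "sqrt S < \<epsilon>" using near by (simp add: H1_norm_def S_def d_def w_def[abs_def])
  moreover have "0 \<le> S" by (simp add: S_def sum_nonneg)
  ultimately have S: "S \<le> \<epsilon>\<^sup>2" using real_sqrt_pow2[of S] power_mono[of "sqrt S" \<epsilon> 2] by simp
  have parts: "(\<integral>x. (w x)\<^sup>2 \<partial>?M) \<le> S" "(\<integral>x. (d (axis 1 1) x)\<^sup>2 \<partial>?M) \<le> S" "(\<integral>x. (d (axis 2 1) x)\<^sup>2 \<partial>?M) \<le> S"
    by (auto simp: S_def Basis_real2 axis_eq_axis)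
  have L1: "(\<integral>x. \<bar>f x\<bar> \<partial>?M) \<le> \<epsilon> * m / 2" if "square_integrable ?M f" "(\<integral>x. (f x)\<^sup>2 \<partial>?M) \<le> S" for f
    using integral_abs_le_of_integral_square[OF that(1) \<epsilon>] that(2) S by (simp add: m_def)
  obtain N where N: "2 \<le> N" "(step 1)\<^sup>2 / 2 \<le> (\<integral>x. w x * (layer N x - layer N (mirror x)) \<partial>?M)"
    using jump_integral_lower_bound[OF v(2)] unfolding w_def by blast
  have "(step 1)\<^sup>2 / 2 \<le> \<epsilon> * m / 2 + 2 * (\<epsilon> * m / 2) + \<epsilon> * m / 2"
    using N(2) jump_bounded_by_H1[OF N(1) sqw, of "d (axis 1 1)" "d (axis 2 1)"] d[OF Basis(1)] d[OF Basis(2)]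
      L1[OF sqw parts(1)] L1[OF _ parts(2)] L1[OF _ parts(3)]
    by linarith
  also have "\<dots> = (step 1)\<^sup>2 / 4" using m by (simp add: \<epsilon>_def field_simps)
  finally show False using step_1_pos by (simp add: field_simps)
qed

theorem lemma4p3:
  shows "\<exists>\<Omega> :: (real^2) set. open \<Omega> \<and> bounded \<Omega> \<and> H1_tr \<Omega> - H1_tilde \<Omega> \<noteq> {}"
  using open_comb bounded_comb indicator_upper_half_in_H1_tr indicator_upper_half_notin_H1_tilde
  by blast

end
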